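(* Let $X$ be a finite set and let $Q$ be an irreducible and reversible Markov kernel on $X$ that is a simple random walk, with maximal vertex degree $D$. Suppose that $Q$ has strictly positive entropic Ricci curvature, $\operatorname{Ric}(Q)\ge\kappa>0$ (with $\theta$ the logarithmic mean). Then the diameter of the underlying graph satisfies $$\operatorname{diam}(X)\;\le\;\frac{2}{\kappa}\sqrt{\frac{D\log D}{D-1}},$$ where for $D=1$ the quantity $\frac{D\log D}{D-1}$ is understood as its limiting value $1$.
   Context: Markov chain. $X$ is a finite set and $Q:X\times X\to[0,\infty)$ is a Markov kernel: $\sum_{y\in X}Q(x,y)=1$ for all $x$. $Q$ is irreducible, with unique stationary probability measure $\pi$ on $X$, and reversible: $Q(x,y)\pi(x)=Q(y,x)\pi(y)$ for all $x,y\in X$. $C(X)$ is the set of functions $X\to\mathbb{R}$. Graph structure. Write $x\sim y$ if and only if $Q(x,y)>0$; this makes $X$ a connected undirected graph. $N(x)=\{y\in X: x\sim y\}$, $d_x=|N(x)|$ is the degree of $x$, and $D=\max_{x\in X}d_x$. $d(x,y)$ is the combinatorial distance (length of a shortest path) and $\operatorname{diam}(X)=\max_{x,y\in X}d(x,y)$. $Q$ is a simple random walk if $Q(x,y)=1/d_x$ for all $y\in N(x)$ (and $Q(x,y)=0$ otherwise); then $\pi(x)=d_x/\sum_{v\in X}d_v$. Operators. For $f\in C(X)$ and $V:X\times X\to\mathbb{R}$: $\nabla f(x,y)=f(y)-f(x)$; $\nabla\cdot V(x)=\frac12\sum_{y\in X}(V(x,y)-V(y,x))Q(x,y)$. Logarithmic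 mean. $\theta(a,b)=\frac{a-b}{\log a-\log b}$ for $a,b>0$, $a\neq b$, extended continuously by $\theta(a,a)=a$ and $\theta(a,0)=\theta(0,a)=0$ for $a\ge 0$. Probability densities and entropy. $\mathscr{D}(X)=\{\rho:X\to[0,\infty):\sum_{x\in X}\pi(x)\rho(x)=1\}$. For $\rho\in\mathscr{D}(X)$ put $\hat\rho(x,y)=\theta(\rho(x),\rho(y))$ and $\mathcal{H}(\rho)=\sum_{x\in X}\rho(x)\log\rho(x)\,\pi(x)$ (with $0\log 0=0$). For $f\in C(X)$ put $\mathcal{A}(\rho,f)=\frac12\sum_{x,y\in X}(f(y)-f(x))^2\hat\rho(x,y)Q(x,y)\pi(x)$. Discrete transport metric. For $\bar\rho_0,\bar\rho_1\in\mathscr{D}(X)$, $\mathcal{W}(\bar\rho_0,\bar\rho_1)=\inf\big\{\int_0^1\mathcal{A}(\rho_t,f_t)\,dt\big\}^{1/2}$, where the infimum is over all pairs of sufficiently regular curves $(\rho_t)_{t\in[0,1]}$ in $\mathscr{D}(X)$ and $(f_t)_{t\in[0,1]}$ in $C(X)$ (say, $\rho$ continuous and piecewise $C^1$ and $f$ measurable in $t$) with $\rho_0=\bar\rho_0$, $\rho_1=\bar\rho_1$ that satisfy the continuity equation $\partial_t\rho_t+\nabla\cdot(\hat\rho_t\nabla f_t)=0$ (for a.e. $t$). $\mathcal{W}$ is a metric on $\mathscr{D}(X)$. A constant speed geodesic is a curve $(\rho_t)_{t\in[0,1]}$ in $\mathscr{D}(X)$ with $\mathcal{W}(\rho_s,\rho_t)=|s-t|\,\mathcal{W}(\rho_0,\rho_1)$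 for all $s,t\in[0,1]$. Entropic curvature. $Q$ has entropic curvature at least $\kappa\in\mathbb{R}$, written $\operatorname{Ric}(Q)\ge\kappa$, if and only if for every constant speed geodesic $(\rho_t)_{t\in[0,1]}$ in $(\mathscr{D}(X),\mathcal{W})$ and every $t\in[0,1]$, $$\mathcal{H}(\rho_t)\le(1-t)\mathcal{H}(\rho_0)+t\,\mathcal{H}(\rho_1)-\frac{\kappa}{2}t(1-t)\mathcal{W}(\rho_0,\rho_1)^2.$$ *)

theory Defs
  imports "HOL-Analysis.Analysis"
begin

text \<open>The finite state space is the universe of a type \<open>'a :: finite\<close>; a kernel is a function
  \<open>Q :: 'a \<Rightarrow> 'a \<Rightarrow> real\<close>, and \<open>\<pi>\<close> always denotes its stationary probability vector.\<close>

subsection \<open>Markov kernels and their graphs\<close>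

definition markov_kernel :: "('a::finite \<Rightarrow> 'a \<Rightarrow> real) \<Rightarrow> bool" where
  "markov_kernel Q \<longleftrightarrow> (\<forall>x y. 0 \<le> Q x y) \<and> (\<forall>x. (\<Sum>y\<in>UNIV. Q x y) = 1)"

definition adjacent :: "('a::finite \<Rightarrow> 'a \<Rightarrow> real) \<Rightarrow> 'a \<Rightarrow> 'a \<Rightarrow> bool" where
  "adjacent Q x y \<longleftrightarrow> Q x y > 0"

definition irreducible_kernel :: "('a::finite \<Rightarrow> 'a \<Rightarrow> real) \<Rightarrow> bool" where
  "irreducible_kernel Q \<longleftrightarrow> (\<forall>x y. (adjacent Q)\<^sup>*\<^sup>* x y)"

definition stationary :: "('a::finite \<Rightarrow> 'a \<Rightarrow> real) \<Rightarrow> ('a \<Rightarrow> real) \<Rightarrow> bool" where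
  "stationary Q \<pi> \<longleftrightarrow> (\<forall>x. 0 \<le> \<pi> x) \<and> (\<Sum>x\<in>UNIV. \<pi> x) = 1 \<and>
     (\<forall>y. (\<Sum>x\<in>UNIV. \<pi> x * Q x y) = \<pi> y)"

definition reversible_kernel :: "('a::finite \<Rightarrow> 'a \<Rightarrow> real) \<Rightarrow> ('a \<Rightarrow> real) \<Rightarrow> bool" where
  "reversible_kernel Q \<pi> \<longleftrightarrow> (\<forall>x y. Q x y * \<pi> x = Q y x * \<pi> y)"

definition neighbours :: "('a::finite \<Rightarrow> 'a \<Rightarrow> real) \<Rightarrow> 'a \<Rightarrow> 'a set" where
  "neighbours Q x = {y. adjacent Q x y}"

text \<open>If \<open>Q x x > 0\<close>, then \<open>x\<close> is its own neighbour and contributes 1 to its degree.\<close>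

definition vdegree :: "('a::finite \<Rightarrow> 'a \<Rightarrow> real) \<Rightarrow> 'a \<Rightarrow> nat" where
  "vdegree Q x = card (neighbours Q x)"

definition max_degree :: "('a::finite \<Rightarrow> 'a \<Rightarrow> real) \<Rightarrow> nat" where
  "max_degree Q = Max (range (vdegree Q))"

text \<open>\<open>(adjacent Q ^^ n) x y\<close> says that there is a walk of length \<open>n\<close> from \<open>x\<close> to \<open>y\<close>;
  a shortest walk is a shortest path.\<close>

definition graph_dist :: "('a::finite \<Rightarrow> 'a \<Rightarrow> real) \<Rightarrow> 'a \<Rightarrow> 'a \<Rightarrow> nat" where
  "graph_dist Q x y = (LEAST n. (adjacent Q ^^ n) x y)"

definition graph_diam :: "('a::finite \<Rightarrow> 'a \<Rightarrow> real) \<Rightarrow> nat" where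
  "graph_diam Q = Max (range (\<lambda>(x, y). graph_dist Q x y))"

definition simple_random_walk :: "('a::finite \<Rightarrow> 'a \<Rightarrow> real) \<Rightarrow> bool" where
  "simple_random_walk Q \<longleftrightarrow>
     (\<forall>x y. Q x y = (if y \<in> neighbours Q x then 1 / real (vdegree Q x) else 0))"

subsection \<open>The discrete transport metric\<close>

definition grad :: "('a::finite \<Rightarrow> real) \<Rightarrow> 'a \<Rightarrow> 'a \<Rightarrow> real" where
  "grad f x y = f y - f x"

definition diverg :: "('a::finite \<Rightarrow> 'a \<Rightarrow> real) \<Rightarrow> ('a \<Rightarrow> 'a \<Rightarrow> real) \<Rightarrow> 'a \<Rightarrow> real" where
  "diverg Q V x = (1/2) * (\<Sum>y\<in>UNIV. (V x y - V y x) * Q x y)"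

text \<open>Only used for nonnegative arguments.\<close>

definition log_mean :: "real \<Rightarrow> real \<Rightarrow> real" where
  "log_mean a b = (if a = b then a else if a = 0 \<or> b = 0 then 0 else (a - b) / (ln a - ln b))"

definition densities :: "('a::finite \<Rightarrow> real) \<Rightarrow> ('a \<Rightarrow> real) set" where
  "densities \<pi> = {\<rho>. (\<forall>x. 0 \<le> \<rho> x) \<and> (\<Sum>x\<in>UNIV. \<pi> x * \<rho> x) = 1}"

definition rho_hat :: "('a::finite \<Rightarrow> real) \<Rightarrow> 'a \<Rightarrow> 'a \<Rightarrow> real" where
  "rho_hat \<rho> x y = log_mean (\<rho> x) (\<rho> y)"

definition rel_entropy :: "('a::finite \<Rightarrow> real) \<Rightarrow> ('a \<Rightarrow> real) \<Rightarrow> real" where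
  "rel_entropy \<pi> \<rho> = (\<Sum>x\<in>UNIV. \<rho> x * ln (\<rho> x) * \<pi> x)"

definition action ::
  "('a::finite \<Rightarrow> 'a \<Rightarrow> real) \<Rightarrow> ('a \<Rightarrow> real) \<Rightarrow> ('a \<Rightarrow> real) \<Rightarrow> ('a \<Rightarrow> real) \<Rightarrow> real" where
  "action Q \<pi> \<rho> f =
     (1/2) * (\<Sum>x\<in>UNIV. \<Sum>y\<in>UNIV. (f y - f x)\<^sup>2 * rho_hat \<rho> x y * Q x y * \<pi> x)"

text \<open>Regularity is imposed coordinatewise, which for a finite state space is the same as
  regularity of the curves in \<open>\<real>\<^sup>X\<close>. Note that \<open>piecewise_C1_differentiable_on\<close>
  includes continuity on the whole interval.\<close>

definition continuity_eq_curves ::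
  "('a::finite \<Rightarrow> 'a \<Rightarrow> real) \<Rightarrow> ('a \<Rightarrow> real) \<Rightarrow> ('a \<Rightarrow> real) \<Rightarrow> ('a \<Rightarrow> real) \<Rightarrow>
   ((real \<Rightarrow> 'a \<Rightarrow> real) \<times> (real \<Rightarrow> 'a \<Rightarrow> real)) set" where
  "continuity_eq_curves Q \<pi> \<rho>0 \<rho>1 = {(\<rho>, f).
     (\<forall>t\<in>{0..1}. \<rho> t \<in> densities \<pi>) \<and>
     (\<forall>x. (\<lambda>t. \<rho> t x) piecewise_C1_differentiable_on {0..1}) \<and>
     (\<forall>x. (\<lambda>t. f t x) \<in> borel_measurable (lebesgue_on {0..1})) \<and>
     \<rho> 0 = \<rho>0 \<and> \<rho> 1 = \<rho>1 \<and>
     (AE t in lebesgue_on {0..1}. \<forall>x.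
        ((\<lambda>s. \<rho> s x) has_real_derivative
           - diverg Q (\<lambda>y z. rho_hat (\<rho> t) y z * grad (f t) y z) x) (at t))}"

text \<open>The infimum is taken in \<open>[0,\<infinity>]\<close>, so that curves of infinite action are harmless. For an
  irreducible reversible kernel it is always finite, so \<open>enn2real\<close> loses no information.\<close>

definition transport_dist ::
  "('a::finite \<Rightarrow> 'a \<Rightarrow> real) \<Rightarrow> ('a \<Rightarrow> real) \<Rightarrow> ('a \<Rightarrow> real) \<Rightarrow> ('a \<Rightarrow> real) \<Rightarrow> real" where
  "transport_dist Q \<pi> \<rho>0 \<rho>1 = sqrt (enn2real
     (INF (\<rho>, f)\<in>continuity_eq_curves Q \<pi> \<rho>0 \<rho>1.
        \<integral>\<^sup>+ t. ennreal (action Q \<pi> (\<rho> t) (f t)) \<partial>lebesgue_on {0..1}))"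

definition const_speed_geodesic ::
  "('a::finite \<Rightarrow> 'a \<Rightarrow> real) \<Rightarrow> ('a \<Rightarrow> real) \<Rightarrow> (real \<Rightarrow> 'a \<Rightarrow> real) \<Rightarrow> bool" where
  "const_speed_geodesic Q \<pi> \<rho> \<longleftrightarrow>
     (\<forall>t\<in>{0..1}. \<rho> t \<in> densities \<pi>) \<and>
     (\<forall>s\<in>{0..1}. \<forall>t\<in>{0..1}.
        transport_dist Q \<pi> (\<rho> s) (\<rho> t) = \<bar>s - t\<bar> * transport_dist Q \<pi> (\<rho> 0) (\<rho> 1))"

subsection \<open>Entropic Ricci curvature\<close>

definition entropic_Ric_ge ::
  "('a::finite \<Rightarrow> 'a \<Rightarrow> real) \<Rightarrow> ('a \<Rightarrow> real) \<Rightarrow> real \<Rightarrow> bool" where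
  "entropic_Ric_ge Q \<pi> \<kappa> \<longleftrightarrow> (\<forall>\<rho>. const_speed_geodesic Q \<pi> \<rho> \<longrightarrow>
     (\<forall>t\<in>{0..1}. rel_entropy \<pi> (\<rho> t) \<le>
        (1 - t) * rel_entropy \<pi> (\<rho> 0) + t * rel_entropy \<pi> (\<rho> 1)
        - \<kappa> / 2 * t * (1 - t) * (transport_dist Q \<pi> (\<rho> 0) (\<rho> 1))\<^sup>2))"

end

theory Submission
  imports Defs
begin

text \<open>The geodesic equations of the transport metric are Hamilton's equations for half the action.
  Since the logarithmic mean is concave and 1-homogeneous, the momentum \<open>f\<close> of a solution
  \<open>(\<rho>, f)\<close> with \<open>\<rho> > 0\<close> is a subsolution of the dual Hamilton--Jacobi problem, with equality
  along \<open>\<rho>\<close>. Hence every such solution is globally minimising, and convexity of the entropy along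
  it gives \<open>Hess H \<ge> \<kappa> A\<close> at every positive density. Along the heat flow
  \<open>P\<^sub>t\<close> the derivative of \<open>A(P\<^bsub>t-s\<^esub> \<rho>, P\<^sub>s f)\<close> in \<open>s\<close> is minus twice the Hessian, so that
  \<open>A(\<rho>, P\<^sub>t f) \<le> exp (- 2 \<kappa> t) A(P\<^sub>t \<rho>, f)\<close>. For a 1-Lipschitz \<open>f\<close> and a density concentrated
  near \<open>x\<close> this bounds \<open>\<bar>\<Delta> P\<^sub>t f x\<bar>\<close> by \<open>C exp (- \<kappa> t)\<close> with \<open>C\<^sup>2 = D log D / (D - 1)\<close>.
  Integrating in time, \<open>f x\<close> differs from the constant \<open>P\<^sub>\<infinity> f\<close> by at most \<open>C / \<kappa>\<close>; take for \<open>f\<close>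
  the distance from an endpoint of a diameter.\<close>

subsection \<open>The logarithmic mean\<close>

text \<open>\<open>log_mean a b = b * exp_moment 0 (ln a - ln b)\<close> for positive \<open>a\<close> and \<open>b\<close>; in this form the
  logarithmic mean is visibly smooth across the diagonal.\<close>

definition exp_moment :: "nat \<Rightarrow> real \<Rightarrow> real" where
  "exp_moment n w = integral {0..1} (\<lambda>p. p ^ n * exp (p * w))"

lemma exp_moment_integrable: "(\<lambda>p. p ^ n * exp (p * w)) integrable_on {0..1::real}"
  by (intro integrable_continuous_real continuous_intros)

text \<open>Differentiation under the integral sign: each derivative brings down one more factor
  \<open>p\<close>.\<close>

lemma exp_moment_has_real_derivative [derivative_intros]:
  assumes "(g has_real_derivative g') (at x within S)"
  shows "((\<lambda>x. exp_moment n (g x)) has_real_derivative exp_moment (Suc n) (g x) * g') (at x within S)"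
proof -
  have "((\<lambda>w. integral (cbox 0 1) (\<lambda>p. p ^ n * exp (p * w))) has_real_derivative
      integral (cbox 0 1) (\<lambda>p. p ^ Suc n * exp (p * w))) (at w within UNIV)" for w :: real
    by (rule leibniz_rule_field_derivative)
      (auto intro!: derivative_eq_intros continuous_intros integrable_continuous_real
        simp: split_beta)
  then have "(exp_moment n has_real_derivative exp_moment (Suc n) w) (at w)" for w
    by (simp add: exp_moment_def[abs_def])
  from DERIV_chain2[OF this assms] show ?thesis .
qed

lemma continuous_on_exp_moment [continuous_intros]:
  "continuous_on S g \<Longrightarrow> continuous_on S (\<lambda>x. exp_moment n (g x))"
proof -
  have "continuous_on UNIV (exp_moment n)"
    using exp_moment_has_real_derivative[OF DERIV_ident]
    by (intro DERIV_continuous_on) auto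
  then show "continuous_on S g \<Longrightarrow> continuous_on S (\<lambda>x. exp_moment n (g x))"
    by (rule continuous_on_compose2) auto
qed

lemma exp_moment_0:
  "exp_moment 0 w = (if w = 0 then 1 else (exp w - 1) / w)"
proof (cases "w = 0")
  case False
  have "((\<lambda>p. exp (p * w)) has_integral (exp (1 * w) / w - exp (0 * w) / w)) {0..1}"
    by (rule fundamental_theorem_of_calculus)
      (use False in \<open>auto intro!: derivative_eq_intros
        simp: has_real_derivative_iff_has_vector_derivative[symmetric]\<close>)
  with False show ?thesis
    by (auto simp: exp_moment_def diff_divide_distrib dest: integral_unique)
qed (simp add: exp_moment_def)

lemma exp_moment_1:
  "exp_moment (Suc 0) w = (if w = 0 then 1 / 2 else (w * exp w - exp w + 1) / w\<^sup>2)"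
proof (cases "w = 0")
  case True
  have "((\<lambda>p::real. p) has_integral (1\<^sup>2 / 2 - 0\<^sup>2 / 2)) {0..1}"
    by (rule fundamental_theorem_of_calculus)
      (auto intro!: derivative_eq_intros
        simp: has_real_derivative_iff_has_vector_derivative[symmetric])
  with True show ?thesis
    by (auto simp: exp_moment_def dest: integral_unique)
next
  case False
  have "((\<lambda>p. p * exp (p * w)) has_integral
      ((1 * w - 1) * exp (1 * w) / w\<^sup>2 - (0 * w - 1) * exp (0 * w) / w\<^sup>2)) {0..1}"
    by (rule fundamental_theorem_of_calculus)
      (use False in \<open>auto intro!: derivative_eq_intros
        simp: has_real_derivative_iff_has_vector_derivative[symmetric] field_simps power2_eq_square\<close>)
  with False show ?thesis
    by (auto simp: exp_moment_def field_simps dest!: integral_unique)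
qed

lemma exp_moment_nonneg: "0 \<le> exp_moment n w"
  unfolding exp_moment_def by (rule integral_nonneg[OF exp_moment_integrable]) auto

text \<open>This is the substitution of \<open>1 - p\<close> for \<open>p\<close> in the integral of
  \<open>(1 - p) * exp (p * w)\<close>, checked on the closed forms. It relates the two partial
  derivatives of the logarithmic mean.\<close>

lemma exp_moment_reflect:
  "exp_moment 0 w - exp_moment (Suc 0) w = exp w * exp_moment (Suc 0) (- w)"
  by (simp add: exp_moment_0 exp_moment_1 field_simps power2_eq_square exp_minus)

text \<open>In the variable \<open>exp s\<close>, the moment of order zero is an average of the
  concave powers with exponent \<open>p\<close> in \<open>{0..1}\<close>; the right-hand side is the
  increment of its tangent at \<open>exp r\<close>. The inequality holds for each \<open>p\<close>,
  by convexity of \<open>exp\<close>, and is then integrated.\<close>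

lemma exp_moment_tangent:
  "exp_moment 0 s - exp_moment 0 r \<le> (exp (s - r) - 1) * exp_moment (Suc 0) r"
proof -
  have "((\<lambda>p. p ^ 0 * exp (p * s) - p ^ 0 * exp (p * r)) has_integral
      (exp_moment 0 s - exp_moment 0 r)) {0..1}"
    unfolding exp_moment_def
    by (intro has_integral_diff integrable_integral exp_moment_integrable)
  moreover have "((\<lambda>p. (exp (s - r) - 1) * (p ^ Suc 0 * exp (p * r))) has_integral
      ((exp (s - r) - 1) * exp_moment (Suc 0) r)) {0..1}"
    unfolding exp_moment_def
    by (intro has_integral_mult_right integrable_integral exp_moment_integrable)
  moreover have "p ^ 0 * exp (p * s) - p ^ 0 * exp (p * r)
      \<le> (exp (s - r) - 1) * (p ^ Suc 0 * exp (p * r))" if "p \<in> {0..1}" for p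
  proof -
    have "exp ((1 - p) *\<^sub>R 0 + p *\<^sub>R (s - r)) \<le> (1 - p) * exp 0 + p * exp (s - r)"
      using that by (intro convex_onD[OF exp_convex]) auto
    then have "exp (p * (s - r)) \<le> 1 + p * (exp (s - r) - 1)"
      by (simp add: algebra_simps)
    then have "exp (p * r) * exp (p * (s - r)) \<le> exp (p * r) * (1 + p * (exp (s - r) - 1))"
      by (intro mult_left_mono) auto
    then show ?thesis
      by (simp add: algebra_simps flip: exp_add)
  qed
  ultimately show ?thesis
    by (rule has_integral_le)
qed

text \<open>The partial derivative of \<open>log_mean\<close> in its first argument, at positive
  arguments; by symmetry \<open>log_mean_deriv b a\<close> is the one in the second
  argument.\<close>

definition log_mean_deriv :: "real \<Rightarrow> real \<Rightarrow> real" where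
  "log_mean_deriv a b = b / a * exp_moment (Suc 0) (ln a - ln b)"

lemma log_mean_commute: "log_mean a b = log_mean b a"
  by (auto simp: log_mean_def) (metis minus_diff_eq minus_divide_divide)

lemma log_mean_eq_exp_moment:
  assumes "0 < a" "0 < b"
  shows "log_mean a b = b * exp_moment 0 (ln a - ln b)"
  using assms by (auto simp: log_mean_def exp_moment_0 exp_diff field_simps)

lemma log_mean_deriv_commute:
  assumes "0 < a" "0 < b"
  shows "log_mean_deriv b a = exp_moment 0 (ln a - ln b) - exp_moment (Suc 0) (ln a - ln b)"
  using assms by (simp add: log_mean_deriv_def exp_moment_reflect exp_diff)

lemma log_mean_deriv_nonneg: "0 < a \<Longrightarrow> 0 < b \<Longrightarrow> 0 \<le> log_mean_deriv a b"
  by (simp add: log_mean_deriv_def exp_moment_nonneg)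

text \<open>Euler's identity for a function homogeneous of degree one.\<close>

lemma log_mean_Euler:
  assumes "0 < a" "0 < b"
  shows "log_mean a b = log_mean_deriv a b * a + log_mean_deriv b a * b"
  using assms unfolding log_mean_deriv_commute[OF assms] log_mean_eq_exp_moment[OF assms]
  by (simp add: log_mean_deriv_def algebra_simps)

text \<open>Since the logarithmic mean is concave and positively homogeneous of degree one, it lies
  below its linearisation, which has no constant term.\<close>

lemma log_mean_le_tangent:
  assumes "0 < a" "0 < b" "0 \<le> s" "0 \<le> t"
  shows "log_mean s t \<le> log_mean_deriv a b * s + log_mean_deriv b a * t"
proof (cases "s = 0 \<or> t = 0")
  case True
  then have "log_mean s t = 0"
    by (auto simp: log_mean_def)
  with assms show ?thesis
    by (simp add: log_mean_deriv_nonneg)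
next
  case False
  with assms have st: "0 < s" "0 < t" by auto
  define r where "r = ln a - ln b"
  have "t * (exp_moment 0 (ln s - ln t) - exp_moment 0 r)
      \<le> t * ((exp (ln s - ln t - r) - 1) * exp_moment (Suc 0) r)"
    using st by (intro mult_left_mono exp_moment_tangent) auto
  moreover have "exp (ln s - ln t - r) = s * b / (t * a)"
    using st assms by (simp add: r_def exp_diff)
  moreover have "t * ((s * b / (t * a) - 1) * exp_moment (Suc 0) r)
      = s * b / a * exp_moment (Suc 0) r - t * exp_moment (Suc 0) r"
    using st assms by (simp add: field_simps)
  ultimately have "t * exp_moment 0 (ln s - ln t) \<le>
      s * b / a * exp_moment (Suc 0) r + t * (exp_moment 0 r - exp_moment (Suc 0) r)"
    by (simp add: algebra_simps)
  then show ?thesis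
    using log_mean_eq_exp_moment[OF st] log_mean_deriv_commute[OF assms(1,2)]
    by (simp add: log_mean_deriv_def r_def mult_ac)
qed

lemma log_mean_le_arith:
  assumes "0 < a" "0 < b"
  shows "log_mean a b \<le> (a + b) / 2"
  \<comment> \<open>At the diagonal point \<open>(1, 1)\<close> both partial derivatives equal
    \<open>1 / 2\<close>, so the tangent plane there is the arithmetic mean.\<close>
  using log_mean_le_tangent[of 1 1 a b] assms
  by (simp add: log_mean_deriv_def exp_moment_1)

lemma log_mean_pos:
  assumes "0 < a" "0 < b"
  shows "0 < log_mean a b"
proof (cases "a = b")
  case False
  have "0 < (a - b) / (ln a - ln b)"
    using assms False by (cases "a < b") (auto simp: divide_neg_neg)
  with assms False show ?thesis by (auto simp: log_mean_def)
qed (use assms in \<open>auto simp: log_mean_def\<close>)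

lemma log_mean_nonneg:
  assumes "0 \<le> a" "0 \<le> b"
  shows "0 \<le> log_mean a b"
proof (cases "a = 0 \<or> b = 0")
  case True
  with assms show ?thesis by (auto simp: log_mean_def)
next
  case False
  with assms show ?thesis by (intro less_imp_le log_mean_pos) auto
qed

lemma log_mean_cmult:
  assumes "0 < c" "0 < a" "0 < b"
  shows "log_mean (c * a) (c * b) = c * log_mean a b"
  using assms by (simp add: log_mean_def ln_mult right_diff_distrib)

lemma log_mean_has_real_derivative:
  assumes "(f has_real_derivative f') (at t within S)" "(g has_real_derivative g') (at t within S)"
    and "0 < f t" "0 < g t" and pos: "\<And>s. s \<in> S \<Longrightarrow> 0 < f s" "\<And>s. s \<in> S \<Longrightarrow> 0 < g s"
    and "t \<in> S"
  shows "((\<lambda>s. log_mean (f s) (g s)) has_real_derivative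
    log_mean_deriv (f t) (g t) * f' + log_mean_deriv (g t) (f t) * g') (at t within S)"
proof -
  have "((\<lambda>s. g s * exp_moment 0 (ln (f s) - ln (g s))) has_real_derivative
      g t * (exp_moment (Suc 0) (ln (f t) - ln (g t)) * (f' / f t - g' / g t)) +
      g' * exp_moment 0 (ln (f t) - ln (g t))) (at t within S)"
    using assms by (auto intro!: derivative_eq_intros)
  moreover have "g t * (exp_moment (Suc 0) (ln (f t) - ln (g t)) * (f' / f t - g' / g t)) +
      g' * exp_moment 0 (ln (f t) - ln (g t)) =
    log_mean_deriv (f t) (g t) * f' + log_mean_deriv (g t) (f t) * g'"
    using assms(3,4) unfolding log_mean_deriv_commute[OF assms(3,4)]
    by (simp add: log_mean_deriv_def field_simps)
  ultimately have "((\<lambda>s. g s * exp_moment 0 (ln (f s) - ln (g s))) has_real_derivative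
    log_mean_deriv (f t) (g t) * f' + log_mean_deriv (g t) (f t) * g') (at t within S)"
    by simp
  then show ?thesis
    by (rule has_field_derivative_transform_within[where d = 1])
      (use assms in \<open>auto simp: log_mean_eq_exp_moment\<close>)
qed

subsection \<open>Local solutions of ordinary differential equations\<close>

text \<open>Picard iteration: boundedness of \<open>G\<close> keeps the iterates bounded, and
  \<open>T * L \<le> 1 / 2\<close> makes the integral operator a contraction.\<close>

lemma ode_solution_exists_global_lipschitz:
  fixes G :: "'e::euclidean_space \<Rightarrow> 'e"
  assumes lip: "L-lipschitz_on UNIV G" and bound: "\<And>x. norm (G x) \<le> M"
    and "0 < T" "T * L \<le> 1 / 2"
  obtains z where "z 0 = z0"
    "\<And>t. t \<in> {0..T} \<Longrightarrow> (z has_vector_derivative G (z t)) (at t within {0..T})"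
proof -
  \<comment> \<open>Clamping time to \<open>{0..T}\<close> lets the Picard operator act on bounded
    continuous functions on the whole line, a complete space for Banach's fixed-point
    theorem.\<close>
  define c where "c t = max 0 (min t T)" for t :: real
  have c: "c t \<in> {0..T}" for t using \<open>0 < T\<close> by (auto simp: c_def)
  have G_cont: "continuous_on S (\<lambda>s. G (y s))" if "continuous_on S y" for S and y :: "real \<Rightarrow> 'e"
    using lipschitz_on_continuous_on[OF lip] that by (rule continuous_on_compose2) auto
  define \<Phi> where "\<Phi> y t = z0 + integral {0..c t} (\<lambda>s. G (apply_bcontfun y s))" for y t
  have int: "(\<lambda>s. G (apply_bcontfun y s)) integrable_on {0..u}" for y and u :: real
    by (intro integrable_continuous_real G_cont) auto
  have bcont: "\<Phi> y \<in> bcontfun" for y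
  proof (rule bcontfun_normI)
    have "continuous_on UNIV c"
      unfolding c_def by (intro continuous_intros)
    then have "continuous_on UNIV (\<lambda>t. integral {0..c t} (\<lambda>s. G (apply_bcontfun y s)))"
      using c by (intro continuous_on_compose2[OF indefinite_integral_continuous_1[OF int[of y T]]]) auto
    then show "continuous_on UNIV (\<Phi> y)"
      unfolding \<Phi>_def by (intro continuous_intros)
    fix t
    have "norm (integral {0..c t} (\<lambda>s. G (apply_bcontfun y s))) \<le> M * (c t - 0)"
      using c[of t] by (intro integral_bound G_cont) (auto simp: bound)
    also have "\<dots> \<le> M * T"
      using c[of t] order_trans[OF norm_ge_zero bound] by (intro mult_left_mono) auto
    finally show "norm (\<Phi> y t) \<le> norm z0 + M * T"
      unfolding \<Phi>_def by (intro norm_triangle_le) auto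
  qed
  have contr: "dist (Bcontfun (\<Phi> x)) (Bcontfun (\<Phi> y)) \<le> 1 / 2 * dist x y" for x y
  proof (rule dist_bound)
    fix t
    have "dist (\<Phi> x t) (\<Phi> y t) = norm (integral {0..c t} (\<lambda>s. G (apply_bcontfun x s) - G (apply_bcontfun y s)))"
      by (simp add: \<Phi>_def dist_norm integral_diff int)
    also have "\<dots> \<le> L * dist x y * (c t - 0)"
    proof (rule integral_bound)
      fix s
      have "norm (G (apply_bcontfun x s) - G (apply_bcontfun y s)) \<le> L * dist (apply_bcontfun x s) (apply_bcontfun y s)"
        using lipschitz_onD[OF lip] by (simp add: dist_norm)
      also have "\<dots> \<le> L * dist x y"
        using lipschitz_on_nonneg[OF lip] by (intro mult_left_mono dist_bounded)
      finally show "norm (G (apply_bcontfun x s) - G (apply_bcontfun y s)) \<le> L * dist x y" .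
    qed (use c[of t] in \<open>auto intro!: continuous_intros G_cont\<close>)
    also have "\<dots> \<le> L * dist x y * T"
      using c[of t] lipschitz_on_nonneg[OF lip] by (intro mult_left_mono) auto
    also have "\<dots> \<le> 1 / 2 * dist x y"
      using mult_right_mono[OF \<open>T * L \<le> 1 / 2\<close>, of "dist x y"] by (simp add: mult_ac)
    finally show "dist (apply_bcontfun (Bcontfun (\<Phi> x)) t) (apply_bcontfun (Bcontfun (\<Phi> y)) t)
        \<le> 1 / 2 * dist x y"
      by (simp add: Bcontfun_inverse[OF bcont])
  qed
  obtain y where "Bcontfun (\<Phi> y) = y"
    using banach_fix_type[of "1/2" "\<lambda>y. Bcontfun (\<Phi> y)"] contr by auto
  then have fix_eq: "apply_bcontfun y t = \<Phi> y t" for t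
    by (metis Bcontfun_inverse[OF bcont])
  show ?thesis
  proof (rule that[of y])
    show "apply_bcontfun y 0 = z0"
      unfolding fix_eq using \<open>0 < T\<close> by (simp add: \<Phi>_def c_def)
    fix t assume t: "t \<in> {0..T}"
    have "((\<lambda>u. z0 + integral {0..u} (\<lambda>s. G (apply_bcontfun y s))) has_vector_derivative
        G (apply_bcontfun y t)) (at t within {0..T})"
      using integral_has_vector_derivative[OF G_cont t, of "apply_bcontfun y"]
      by (auto intro!: derivative_eq_intros)
    then show "(y has_vector_derivative G (apply_bcontfun y t)) (at t within {0..T})"
    proof (rule has_vector_derivative_transform_within[where d = 1])
      fix s assume "s \<in> {0..T}"
      then have "c s = s" by (simp add: c_def)
      then show "z0 + integral {0..s} (\<lambda>s. G (apply_bcontfun y s)) = apply_bcontfun y s"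
        unfolding fix_eq[of s] \<Phi>_def by simp
    qed (use t in auto)
  qed
qed

text \<open>Precomposing \<open>F\<close> with the nearest-point projection onto the ball gives a
  bounded, globally Lipschitz field. For a short time its solution stays in the ball, where both
  fields agree.\<close>

lemma ode_solution_exists:
  fixes F :: "'e::euclidean_space \<Rightarrow> 'e"
  assumes lip: "L-lipschitz_on (cball z0 1) F"
  obtains T z where "0 < T" "z 0 = z0"
    "\<And>t. t \<in> {0..T} \<Longrightarrow> (z has_vector_derivative F (z t)) (at t within {0..T})"
proof -
  define C where "C = cball z0 1"
  have C: "convex C" "closed C" "C \<noteq> {}" by (auto simp: C_def)
  define G where "G = F \<circ> closest_point C"
  have L: "0 \<le> L" using lip by (rule lipschitz_on_nonneg)
  have in_C: "closest_point C x \<in> C" for x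
    using C by (intro closest_point_in_set)
  have "L-lipschitz_on UNIV G"
  proof (rule lipschitz_onI)
    fix x y
    have "dist (G x) (G y) \<le> L * dist (closest_point C x) (closest_point C y)"
      using lipschitz_onD[OF lip] in_C by (simp add: G_def C_def)
    also have "\<dots> \<le> L * dist x y"
      using closest_point_lipschitz[OF C] L by (intro mult_left_mono)
    finally show "dist (G x) (G y) \<le> L * dist x y" .
  qed (rule L)
  moreover define M where "M = norm (F z0) + L"
  have M: "norm (G x) \<le> M" for x
  proof -
    have "dist (G x) (F z0) \<le> L * dist (closest_point C x) z0"
      using lipschitz_onD[OF lip] in_C by (simp add: G_def C_def)
    also have "\<dots> \<le> L * 1"
      using in_C[of x] L by (intro mult_left_mono) (auto simp: C_def dist_commute)
    finally have "dist (G x) (F z0) \<le> L" by simp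
    then show ?thesis
      using norm_triangle_sub[of "G x" "F z0"] by (simp add: M_def dist_norm)
  qed
  \<comment> \<open>Short enough both for the contraction and for a curve of speed at most
    \<open>M\<close> to stay within distance 1; the summand 1 avoids division by zero.\<close>
  moreover define T where "T = 1 / (2 * (M + 1))"
  have "0 \<le> M" "L \<le> M" using L by (simp_all add: M_def)
  then have T: "0 < T" "T * L \<le> 1 / 2" "M * T \<le> 1"
    by (auto simp: T_def divide_le_eq)
  ultimately obtain z where z0: "z 0 = z0"
    and z: "\<And>t. t \<in> {0..T} \<Longrightarrow> (z has_vector_derivative G (z t)) (at t within {0..T})"
    using ode_solution_exists_global_lipschitz[of L G M T z0] by metis
  have "F (z t) = G (z t)" if t: "t \<in> {0..T}" for t
  proof -
    have "norm (z t - z 0) \<le> M * norm (t - 0)"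
    proof (rule differentiable_bound[where S = "{0..T}" and f' = "\<lambda>t h. h *\<^sub>R G (z t)"])
      show "(z has_derivative (\<lambda>h. h *\<^sub>R G (z s))) (at s within {0..T})" if "s \<in> {0..T}" for s
        using z[OF that] by (simp add: has_vector_derivative_def)
      show "onorm (\<lambda>h. h *\<^sub>R G (z s)) \<le> M" for s
        using M \<open>0 \<le> M\<close> by (intro onorm_bound) (auto simp: mult.commute[of M] intro!: mult_left_mono)
    qed (use t T in auto)
    also have "\<dots> \<le> M * T"
      using t \<open>0 \<le> M\<close> by (intro mult_left_mono) auto
    finally have "z t \<in> C"
      using T z0 by (simp add: C_def dist_norm norm_minus_commute)
    then show ?thesis by (simp add: G_def closest_point_self)
  qed
  with z z0 T show ?thesis by (intro that[of T z]) auto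
qed

text \<open>Boundedness is carried along because products of Lipschitz functions are in general
  Lipschitz only if the factors are bounded. The class is closed under all operations that build the
  vector field of the geodesic flow.\<close>

definition lipschitz_bounded_on :: "'e::metric_space set \<Rightarrow> ('e \<Rightarrow> real) \<Rightarrow> bool" where
  "lipschitz_bounded_on S f \<longleftrightarrow> (\<exists>L. L-lipschitz_on S f) \<and> bounded (f ` S)"

lemma lipschitz_bounded_on_const: "lipschitz_bounded_on S (\<lambda>_. c)"
  using lipschitz_on_constant[of S c] by (auto simp: lipschitz_bounded_on_def image_constant_conv)

lemma lipschitz_bounded_on_add:
  assumes "lipschitz_bounded_on S f" "lipschitz_bounded_on S g"
  shows "lipschitz_bounded_on S (\<lambda>x. f x + g x)"
  using assms unfolding lipschitz_bounded_on_def by (blast intro: lipschitz_on_add bounded_plus_comp)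

lemma lipschitz_bounded_on_minus:
  assumes "lipschitz_bounded_on S f"
  shows "lipschitz_bounded_on S (\<lambda>x. - f x)"
  using assms unfolding lipschitz_bounded_on_def by (auto simp: lipschitz_on_minus_iff bounded_uminus intro: lipschitz_on_minus)

lemma lipschitz_bounded_on_mult:
  assumes "lipschitz_bounded_on S f" "lipschitz_bounded_on S g"
  shows "lipschitz_bounded_on S (\<lambda>x. f x * g x)"
proof -
  obtain L M where L: "L-lipschitz_on S f" "M-lipschitz_on S g"
    using assms by (auto simp: lipschitz_bounded_on_def)
  obtain A B where AB: "0 < A" "0 < B" "\<And>x. x \<in> S \<Longrightarrow> \<bar>f x\<bar> \<le> A" "\<And>x. x \<in> S \<Longrightarrow> \<bar>g x\<bar> \<le> B"
    using assms unfolding lipschitz_bounded_on_def bounded_pos by (auto simp: ball_simps)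
  have "(A * M + B * L)-lipschitz_on S (\<lambda>x. f x * g x)"
  proof (rule lipschitz_onI)
    fix x y assume xy: "x \<in> S" "y \<in> S"
    have "dist (f x * g x) (f y * g y) = \<bar>f x * (g x - g y) + g y * (f x - f y)\<bar>"
      by (simp add: dist_real_def algebra_simps)
    also have "\<dots> \<le> \<bar>f x\<bar> * \<bar>g x - g y\<bar> + \<bar>g y\<bar> * \<bar>f x - f y\<bar>"
      by (metis abs_mult abs_triangle_ineq)
    also have "\<dots> \<le> A * (M * dist x y) + B * (L * dist x y)"
      using AB xy lipschitz_onD[OF L(1)] lipschitz_onD[OF L(2)]
      by (intro add_mono mult_mono) (auto simp: dist_real_def)
    finally show "dist (f x * g x) (f y * g y) \<le> (A * M + B * L) * dist x y"
      by (simp add: algebra_simps)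
  qed (use AB L[THEN lipschitz_on_nonneg] in auto)
  moreover have "bounded ((\<lambda>x. f x * g x) ` S)"
    using AB by (auto simp: bounded_iff abs_mult intro!: exI[of _ "A * B"] mult_mono)
  ultimately show ?thesis by (auto simp: lipschitz_bounded_on_def)
qed

lemma lipschitz_bounded_on_sum:
  assumes "\<And>i. i \<in> I \<Longrightarrow> lipschitz_bounded_on S (f i)"
  shows "lipschitz_bounded_on S (\<lambda>x. \<Sum>i\<in>I. f i x)"
  using assms
  by (induction I rule: infinite_finite_induct)
    (auto intro: lipschitz_bounded_on_const lipschitz_bounded_on_add)

text \<open>The values of \<open>f\<close> lie in a compact interval, on which the continuous
  derivative of \<open>h\<close> is bounded.\<close>

lemma lipschitz_bounded_on_compose:
  assumes f: "lipschitz_bounded_on S f"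
    and h: "\<And>x::real. (h has_real_derivative h' x) (at x)" "continuous_on UNIV h'"
  shows "lipschitz_bounded_on S (\<lambda>x. h (f x))"
proof -
  obtain L where L: "L-lipschitz_on S f" using f by (auto simp: lipschitz_bounded_on_def)
  obtain A where A: "0 < A" "\<And>x. x \<in> S \<Longrightarrow> f x \<in> {-A..A}"
    using f unfolding lipschitz_bounded_on_def bounded_pos by (fastforce simp: abs_le_iff)
  have "compact (h' ` {-A..A})"
    using h(2) by (intro compact_continuous_image continuous_on_subset[OF h(2)]) auto
  then obtain B where B: "0 < B" "\<And>x. x \<in> {-A..A} \<Longrightarrow> \<bar>h' x\<bar> \<le> B"
    using compact_imp_bounded[of "h' ` {-A..A}"] unfolding bounded_pos by fastforce
  have lip: "B-lipschitz_on {-A..A} h"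
  proof (rule lipschitz_onI)
    fix x y assume "x \<in> {-A..A}" "y \<in> {-A..A}"
    then have "norm (h x - h y) \<le> B * norm (x - y)"
      using B h(1) by (intro field_differentiable_bound[of "{-A..A}" h h'])
        (auto intro: has_field_derivative_at_within)
    then show "dist (h x) (h y) \<le> B * dist x y" by (simp add: dist_norm)
  qed (use B in auto)
  have "(B * L)-lipschitz_on S (\<lambda>x. h (f x))"
    by (rule lipschitz_on_compose2[OF L lipschitz_on_subset[OF lip]]) (use A in fastforce)
  moreover have "bounded (h ` {-A..A})"
    using lip by (intro compact_imp_bounded compact_continuous_image lipschitz_on_continuous_on) auto
  then have "bounded ((\<lambda>x. h (f x)) ` S)"
    by (rule bounded_subset) (use A in auto)
  ultimately show ?thesis by (auto simp: lipschitz_bounded_on_def)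
qed

lemma lipschitz_bounded_on_linear:
  assumes "bounded_linear f" "bounded S"
  shows "lipschitz_bounded_on S f"
proof -
  obtain K where "0 \<le> K" "\<And>x. norm (f x) \<le> norm x * K"
    using bounded_linear.nonneg_bounded[OF assms(1)] by blast
  then have "K-lipschitz_on S f"
    by (intro lipschitz_onI)
      (metis linear_diff[OF bounded_linear.linear[OF assms(1)]] dist_norm mult.commute, assumption)
  with bounded_linear_image[OF assms(2,1)] show ?thesis
    by (auto simp: lipschitz_bounded_on_def)
qed

lemma lipschitz_on_vec_pairI:
  fixes F :: "'e::metric_space \<Rightarrow> (real ^ 'n) \<times> (real ^ 'n)"
  assumes "\<And>i. lipschitz_bounded_on S (\<lambda>x. fst (F x) $ i)"
    and "\<And>i. lipschitz_bounded_on S (\<lambda>x. snd (F x) $ i)"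
  obtains L where "L-lipschitz_on S F"
proof -
  obtain A where A: "\<And>i. (A i)-lipschitz_on S (\<lambda>x. fst (F x) $ i)"
    using assms(1) unfolding lipschitz_bounded_on_def by metis
  obtain B where B: "\<And>i. (B i)-lipschitz_on S (\<lambda>x. snd (F x) $ i)"
    using assms(2) unfolding lipschitz_bounded_on_def by metis
  have vec: "(\<Sum>i\<in>UNIV. A i)-lipschitz_on S G" 
    if A: "\<And>i. (A i)-lipschitz_on S (\<lambda>x. G x $ i)" for A and G :: "'e \<Rightarrow> real ^ 'n"
  proof (rule lipschitz_onI)
    fix x y assume xy: "x \<in> S" "y \<in> S"
    have "dist (G x) (G y) \<le> (\<Sum>i\<in>UNIV. \<bar>(G x - G y) $ i\<bar>)"
      unfolding dist_norm by (rule norm_le_l1_cart)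
    also have "\<dots> \<le> (\<Sum>i\<in>UNIV. A i * dist x y)"
      using lipschitz_onD[OF A xy] by (intro sum_mono) (auto simp: dist_real_def)
    finally show "dist (G x) (G y) \<le> (\<Sum>i\<in>UNIV. A i) * dist x y"
      by (simp add: sum_distrib_right)
  qed (intro sum_nonneg lipschitz_on_nonneg[OF A])
  from lipschitz_on_Pair[OF vec[OF A] vec[OF B]] show ?thesis
    by (intro that) auto
qed

subsection \<open>Calculus on a reversible chain\<close>

definition laplace :: "('a::finite \<Rightarrow> 'a \<Rightarrow> real) \<Rightarrow> ('a \<Rightarrow> real) \<Rightarrow> 'a \<Rightarrow> real" where
  "laplace Q f x = (\<Sum>y\<in>UNIV. (f y - f x) * Q x y)"

text \<open>The right-hand side of the continuity equation; with respect to the weights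
  \<open>\<pi>\<close> it is the gradient of \<open>action / 2\<close> in \<open>f\<close>.\<close>

definition velocity ::
  "('a::finite \<Rightarrow> 'a \<Rightarrow> real) \<Rightarrow> ('a \<Rightarrow> real) \<Rightarrow> ('a \<Rightarrow> real) \<Rightarrow> 'a \<Rightarrow> real" where
  "velocity Q \<rho> f x = - diverg Q (\<lambda>y z. rho_hat \<rho> y z * grad f y z) x"

text \<open>With respect to the weights \<open>\<pi>\<close>, minus the gradient of
  \<open>action / 2\<close> in the density.\<close>

definition force ::
  "('a::finite \<Rightarrow> 'a \<Rightarrow> real) \<Rightarrow> ('a \<Rightarrow> real) \<Rightarrow> ('a \<Rightarrow> real) \<Rightarrow> 'a \<Rightarrow> real" where
  "force Q \<rho> f x = - (\<Sum>y\<in>UNIV. (f y - f x)\<^sup>2 * log_mean_deriv (\<rho> x) (\<rho> y) * Q x y) / 2"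

text \<open>The second derivative of the entropy along the geodesic flow through
  \<open>(\<rho>, f)\<close>.\<close>

definition entropy_hessian ::
  "('a::finite \<Rightarrow> 'a \<Rightarrow> real) \<Rightarrow> ('a \<Rightarrow> real) \<Rightarrow> ('a \<Rightarrow> real) \<Rightarrow> ('a \<Rightarrow> real) \<Rightarrow> real" where
  "entropy_hessian Q \<pi> \<rho> f =
     - (\<Sum>x\<in>UNIV. (laplace Q f x * velocity Q \<rho> f x + laplace Q \<rho> x * force Q \<rho> f x) * \<pi> x)"

lemma rho_hat_commute: "rho_hat \<rho> x y = rho_hat \<rho> y x"
  by (simp add: rho_hat_def log_mean_commute)

lemma velocity_eq: "velocity Q \<rho> f x = - (\<Sum>y\<in>UNIV. rho_hat \<rho> x y * (f y - f x) * Q x y)"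
  unfolding velocity_def diverg_def grad_def sum_distrib_left
  by (simp add: rho_hat_commute[of \<rho> _ x] algebra_simps)

locale reversible_chain =
  fixes Q :: "'a::finite \<Rightarrow> 'a \<Rightarrow> real" and \<pi> :: "'a \<Rightarrow> real"
  assumes Q_nonneg: "0 \<le> Q x y"
    and Q_sum: "(\<Sum>y\<in>UNIV. Q x y) = 1"
    and \<pi>_pos: "0 < \<pi> x"
    and \<pi>_sum: "(\<Sum>x\<in>UNIV. \<pi> x) = 1"
    and reversible: "Q x y * \<pi> x = Q y x * \<pi> y"
begin

section \<open>Summation by parts over the edges\<close>

definition edge_sum :: "('a \<Rightarrow> 'a \<Rightarrow> real) \<Rightarrow> real" where
  "edge_sum G = (\<Sum>x\<in>UNIV. \<Sum>y\<in>UNIV. G x y * Q x y * \<pi> x) / 2"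

lemma edge_sum_swap: "edge_sum G = edge_sum (\<lambda>x y. G y x)"
proof -
  have "(\<Sum>x\<in>UNIV. \<Sum>y\<in>UNIV. G x y * Q x y * \<pi> x) = (\<Sum>x\<in>UNIV. \<Sum>y\<in>UNIV. G x y * Q y x * \<pi> y)"
    using reversible by (intro sum.cong refl) (simp add: mult.assoc)
  also have "\<dots> = (\<Sum>x\<in>UNIV. \<Sum>y\<in>UNIV. G y x * Q x y * \<pi> x)"
    by (rule sum.swap)
  finally show ?thesis by (simp add: edge_sum_def)
qed

lemma edge_sum_add: "edge_sum (\<lambda>x y. G x y + H x y) = edge_sum G + edge_sum H"
  by (simp add: edge_sum_def distrib_right sum.distrib add_divide_distrib)

lemma edge_sum_minus: "edge_sum (\<lambda>x y. - G x y) = - edge_sum G"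
  by (simp add: edge_sum_def sum_negf)

lemma edge_sum_diff: "edge_sum (\<lambda>x y. G x y - H x y) = edge_sum G - edge_sum H"
  using edge_sum_add[of G "\<lambda>x y. - H x y"] by (simp add: edge_sum_minus)

lemma edge_sum_cmult: "edge_sum (\<lambda>x y. c * G x y) = c * edge_sum G"
  by (simp add: edge_sum_def sum_distrib_left mult.assoc)

lemma edge_sum_mono:
  assumes "\<And>x y. 0 < Q x y \<Longrightarrow> G x y \<le> H x y"
  shows "edge_sum G \<le> edge_sum H"
proof -
  have "G x y * Q x y \<le> H x y * Q x y" for x y
    using assms[of x y] Q_nonneg[of x y] by (cases "Q x y = 0") (auto intro: mult_right_mono)
  then show ?thesis
    unfolding edge_sum_def by (intro divide_right_mono sum_mono mult_right_mono[OF _ less_imp_le[OF \<pi>_pos]]) auto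
qed

lemma edge_sum_has_real_derivative:
  assumes "\<And>x y. ((\<lambda>t. G t x y) has_real_derivative G' x y) (at t within S)"
  shows "((\<lambda>t. edge_sum (G t)) has_real_derivative edge_sum G') (at t within S)"
  unfolding edge_sum_def
  by (intro DERIV_cdivide DERIV_sum DERIV_cmult_right assms)

lemma action_eq_edge_sum: "action Q \<pi> \<rho> f = edge_sum (\<lambda>x y. (f y - f x)\<^sup>2 * rho_hat \<rho> x y)"
  by (simp add: action_def edge_sum_def)

lemma action_nonneg:
  assumes "\<And>x. 0 \<le> \<rho> x"
  shows "0 \<le> action Q \<pi> \<rho> f"
proof -
  have "edge_sum (\<lambda>x y. 0) \<le> action Q \<pi> \<rho> f"
    unfolding action_eq_edge_sum
    by (intro edge_sum_mono) (auto simp: rho_hat_def log_mean_nonneg assms)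
  then show ?thesis by (simp add: edge_sum_def)
qed

text \<open>Summation by parts: averaging over the two orientations of each edge moves the
  divergence onto \<open>g\<close> as a gradient.\<close>

lemma sum_velocity:
  "(\<Sum>x\<in>UNIV. g x * velocity Q \<rho> f x * \<pi> x)
    = edge_sum (\<lambda>x y. (g y - g x) * (f y - f x) * rho_hat \<rho> x y)"
proof -
  define V where "V x y = g x * (rho_hat \<rho> x y * (f y - f x))" for x y
  have "(\<Sum>x\<in>UNIV. g x * velocity Q \<rho> f x * \<pi> x)
      = - (\<Sum>x\<in>UNIV. \<Sum>y\<in>UNIV. V x y * Q x y * \<pi> x)"
    by (simp add: velocity_eq V_def sum_distrib_left sum_distrib_right sum_negf mult_ac)
  also have "\<dots> = - 2 * edge_sum V"
    by (simp add: edge_sum_def)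
  also have "\<dots> = edge_sum (\<lambda>x y. - V x y - V y x)"
    using edge_sum_swap[of V] by (simp add: edge_sum_diff edge_sum_minus)
  also have "(\<lambda>x y. - V x y - V y x) = (\<lambda>x y. (g y - g x) * (f y - f x) * rho_hat \<rho> x y)"
    by (intro ext) (simp add: V_def rho_hat_commute[of \<rho> y x for x y] algebra_simps)
  finally show ?thesis .
qed

text \<open>The same symmetrisation. For positive densities the result is minus the derivative of
  half the action when the density moves in direction \<open>g\<close>.\<close>

lemma sum_force:
  "(\<Sum>x\<in>UNIV. g x * force Q \<rho> f x * \<pi> x) =
    - edge_sum (\<lambda>x y. (f y - f x)\<^sup>2 *
        (log_mean_deriv (\<rho> x) (\<rho> y) * g x + log_mean_deriv (\<rho> y) (\<rho> x) * g y)) / 2"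
proof -
  define V where "V x y = g x * ((f y - f x)\<^sup>2 * log_mean_deriv (\<rho> x) (\<rho> y))" for x y
  have "(\<Sum>x\<in>UNIV. g x * force Q \<rho> f x * \<pi> x) = - edge_sum V"
    by (simp add: force_def edge_sum_def V_def sum_distrib_left sum_distrib_right mult_ac
        sum_divide_distrib flip: sum_negf)
  also have "\<dots> = - (edge_sum (\<lambda>x y. V x y + V y x)) / 2"
    using edge_sum_swap[of V] by (simp add: edge_sum_add)
  also have "(\<lambda>x y. V x y + V y x) = (\<lambda>x y. (f y - f x)\<^sup>2 *
        (log_mean_deriv (\<rho> x) (\<rho> y) * g x + log_mean_deriv (\<rho> y) (\<rho> x) * g y))"
    by (intro ext) (simp add: V_def algebra_simps power2_commute)
  finally show ?thesis by simp
qed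

lemma sum_laplace:
  "(\<Sum>x\<in>UNIV. g x * laplace Q f x * \<pi> x) = - edge_sum (\<lambda>x y. (g y - g x) * (f y - f x))"
proof -
  define V where "V x y = g x * (f y - f x)" for x y
  have "(\<Sum>x\<in>UNIV. g x * laplace Q f x * \<pi> x) = 2 * edge_sum V"
    by (simp add: laplace_def edge_sum_def V_def sum_distrib_left sum_distrib_right mult_ac)
  also have "\<dots> = - edge_sum (\<lambda>x y. - V x y - V y x)"
    using edge_sum_swap[of V] by (simp add: edge_sum_diff edge_sum_minus)
  also have "(\<lambda>x y. - V x y - V y x) = (\<lambda>x y. (g y - g x) * (f y - f x))"
    by (intro ext) (simp add: V_def algebra_simps)
  finally show ?thesis by simp
qed

lemma laplace_self_adjoint:
  "(\<Sum>x\<in>UNIV. g x * laplace Q f x * \<pi> x) = (\<Sum>x\<in>UNIV. f x * laplace Q g x * \<pi> x)"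
  unfolding sum_laplace by (simp add: mult.commute)

text \<open>The right-hand side is the linearisation of the action at \<open>\<rho>\<close>,
  evaluated at \<open>\<sigma>\<close>; the tangent inequality for the logarithmic mean applies on
  each edge. At \<open>\<sigma> = \<rho>\<close> Euler's identity gives equality.\<close>

lemma action_le_sum_force:
  assumes "\<And>x. 0 < \<rho> x" "\<And>x. 0 \<le> \<sigma> x"
  shows "action Q \<pi> \<sigma> f \<le> - 2 * (\<Sum>x\<in>UNIV. \<sigma> x * force Q \<rho> f x * \<pi> x)"
  unfolding sum_force action_eq_edge_sum using assms
  by (auto intro!: edge_sum_mono mult_left_mono log_mean_le_tangent simp: rho_hat_def)

lemma action_eq_sum_force:
  assumes "\<And>x. 0 < \<rho> x"
  shows "action Q \<pi> \<rho> f = - 2 * (\<Sum>x\<in>UNIV. \<rho> x * force Q \<rho> f x * \<pi> x)"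
  unfolding sum_force action_eq_edge_sum rho_hat_def using log_mean_Euler[OF assms assms] by simp

lemma action_eq_sum_velocity:
  "action Q \<pi> \<rho> f = (\<Sum>x\<in>UNIV. f x * velocity Q \<rho> f x * \<pi> x)"
  unfolding sum_velocity action_eq_edge_sum by (simp add: power2_eq_square)

text \<open>Young's inequality splits the product of the two gradients into half the action of
  \<open>f\<close> and half that of \<open>g\<close>, both at \<open>\<sigma>\<close>; the force
  term compensates the former by concavity.\<close>

lemma calibration_bound:
  assumes "\<And>x. 0 < \<rho> x" "\<And>x. 0 \<le> \<sigma> x"
  shows "(\<Sum>x\<in>UNIV. (f x * velocity Q \<sigma> g x + \<sigma> x * force Q \<rho> f x) * \<pi> x) \<le> action Q \<pi> \<sigma> g / 2"
proof -
  have "edge_sum (\<lambda>x y. (f y - f x) * (g y - g x) * rho_hat \<sigma> x y)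
      \<le> edge_sum (\<lambda>x y. 1 / 2 * ((f y - f x)\<^sup>2 * rho_hat \<sigma> x y) + 1 / 2 * ((g y - g x)\<^sup>2 * rho_hat \<sigma> x y))"
  proof (rule edge_sum_mono)
    fix x y
    have "(f y - f x) * (g y - g x) \<le> 1 / 2 * (f y - f x)\<^sup>2 + 1 / 2 * (g y - g x)\<^sup>2"
      using sum_squares_bound[of "f y - f x" "g y - g x"] by (simp only: mult.assoc)
    from mult_right_mono[OF this, of "rho_hat \<sigma> x y"]
    show "(f y - f x) * (g y - g x) * rho_hat \<sigma> x y
        \<le> 1 / 2 * ((f y - f x)\<^sup>2 * rho_hat \<sigma> x y) + 1 / 2 * ((g y - g x)\<^sup>2 * rho_hat \<sigma> x y)"
      using assms(2) by (simp add: rho_hat_def log_mean_nonneg distrib_right)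
  qed
  also have "\<dots> = action Q \<pi> \<sigma> f / 2 + action Q \<pi> \<sigma> g / 2"
    by (simp only: edge_sum_add edge_sum_cmult action_eq_edge_sum)
  finally show ?thesis
    using action_le_sum_force[of \<rho> \<sigma> f, OF assms] sum_velocity[where g=f and f=g and \<rho>=\<sigma>]
    by (simp add: distrib_right sum.distrib)
qed

text \<open>Twice the differential of the Hamiltonian \<open>action / 2\<close>. The two terms
  cancel along Hamilton's equations, and the formula is reused for the heat flow.\<close>

lemma action_has_real_derivative:
  assumes \<rho>: "\<And>x. ((\<lambda>t. \<rho> t x) has_real_derivative \<rho>' x) (at t within S)"
    and f: "\<And>x. ((\<lambda>t. f t x) has_real_derivative f' x) (at t within S)"
    and pos: "\<And>s x. s \<in> S \<Longrightarrow> 0 < \<rho> s x" and "t \<in> S"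
  shows "((\<lambda>t. action Q \<pi> (\<rho> t) (f t)) has_real_derivative
    2 * (\<Sum>x\<in>UNIV. (f' x * velocity Q (\<rho> t) (f t) x - \<rho>' x * force Q (\<rho> t) (f t) x) * \<pi> x)) (at t within S)"
proof -
  define G' where "G' x y = 2 * ((f' y - f' x) * (f t y - f t x) * rho_hat (\<rho> t) x y) +
      (f t y - f t x)\<^sup>2 * (log_mean_deriv (\<rho> t x) (\<rho> t y) * \<rho>' x + log_mean_deriv (\<rho> t y) (\<rho> t x) * \<rho>' y)" for x y
  have "((\<lambda>t. action Q \<pi> (\<rho> t) (f t)) has_real_derivative edge_sum G') (at t within S)"
    unfolding action_eq_edge_sum
  proof (rule edge_sum_has_real_derivative)
    fix x y
    have "((\<lambda>t. rho_hat (\<rho> t) x y) has_real_derivative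
      log_mean_deriv (\<rho> t x) (\<rho> t y) * \<rho>' x + log_mean_deriv (\<rho> t y) (\<rho> t x) * \<rho>' y) (at t within S)"
      unfolding rho_hat_def using assms by (intro log_mean_has_real_derivative) auto
    with f show "((\<lambda>t. (f t y - f t x)\<^sup>2 * rho_hat (\<rho> t) x y) has_real_derivative G' x y) (at t within S)"
      by (auto intro!: derivative_eq_intros simp: G'_def)
  qed
  also have "edge_sum G' = 2 * (\<Sum>x\<in>UNIV. f' x * velocity Q (\<rho> t) (f t) x * \<pi> x)
      - 2 * (\<Sum>x\<in>UNIV. \<rho>' x * force Q (\<rho> t) (f t) x * \<pi> x)"
    unfolding G'_def edge_sum_add edge_sum_cmult sum_velocity sum_force by simp
  finally show ?thesis
    by (simp add: left_diff_distrib sum_subtractf right_diff_distrib)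
qed

lemma rel_entropy_has_real_derivative:
  assumes \<rho>: "\<And>x. ((\<lambda>t. \<rho> t x) has_real_derivative velocity Q (\<rho> t) f x) (at t within S)"
    and pos: "\<And>x. 0 < \<rho> t x"
  shows "((\<lambda>t. rel_entropy \<pi> (\<rho> t)) has_real_derivative
    - (\<Sum>x\<in>UNIV. \<rho> t x * laplace Q f x * \<pi> x)) (at t within S)"
proof -
  have "((\<lambda>t. rel_entropy \<pi> (\<rho> t)) has_real_derivative
      (\<Sum>x\<in>UNIV. (ln (\<rho> t x) + 1) * velocity Q (\<rho> t) f x * \<pi> x)) (at t within S)"
    unfolding rel_entropy_def using pos
    by (intro DERIV_sum) (auto intro!: derivative_eq_intros \<rho> simp: field_simps less_imp_neq[symmetric])
  also have "(\<Sum>x\<in>UNIV. (ln (\<rho> t x) + 1) * velocity Q (\<rho> t) f x * \<pi> x) =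
      edge_sum (\<lambda>x y. (\<rho> t y - \<rho> t x) * (f y - f x))"
  proof -
    \<comment> \<open>The property that singles out the logarithmic mean: it turns the gradient of
      \<open>ln \<rho>\<close> into that of \<open>\<rho>\<close>, which makes the entropy
      derivative linear in \<open>\<rho>\<close>.\<close>
    have *: "(ln b - ln a) * c * log_mean a b = (b - a) * c" if "0 < a" "0 < b" for a b c :: real
    proof (cases "a = b")
      case False
      with that have "ln b - ln a \<noteq> 0" "ln a - ln b \<noteq> 0" by auto
      with False that show ?thesis by (simp add: log_mean_def divide_simps) (simp add: algebra_simps)
    qed simp
    show ?thesis
      unfolding sum_velocity rho_hat_def add_diff_cancel_right *[OF pos pos] ..
  qed
  finally show ?thesis
    unfolding sum_laplace by simp
qed

end

subsection \<open>Minimality of the geodesic flow\<close>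

text \<open>Connects the gauge integral of the fundamental theorem of calculus with the integral in
  \<open>transport_dist\<close>: \<open>ennreal\<close> discards the negative part of
  \<open>g\<close>, and the positive part is integrable unless the right-hand side is
  infinite.\<close>

lemma has_integral_le_nn_integral:
  fixes g :: "real \<Rightarrow> real"
  assumes g: "(g has_integral v) S" and S: "S \<in> sets lebesgue"
  shows "ennreal v \<le> (\<integral>\<^sup>+ t. ennreal (g t) \<partial>lebesgue_on S)"
proof (cases "(\<integral>\<^sup>+ t. ennreal (g t) \<partial>lebesgue_on S) = \<infinity>")
  case False
  define p where "p t = max 0 (g t)" for t
  have p_nn: "(\<integral>\<^sup>+ t. ennreal (p t) \<partial>lebesgue_on S) = (\<integral>\<^sup>+ t. ennreal (g t) \<partial>lebesgue_on S)"
    by (simp add: p_def ennreal_max_0)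
  have "g \<in> borel_measurable (lebesgue_on S)"
    using g by (intro integrable_imp_measurable) auto
  then have "p \<in> borel_measurable (lebesgue_on S)"
    unfolding p_def by measurable
  with False have int: "integrable (lebesgue_on S) p"
    by (intro integrableI_nonneg) (auto simp: p_nn less_top[symmetric], auto simp: p_def)
  have "v \<le> integral\<^sup>L (lebesgue_on S) p"
    by (rule has_integral_le[OF g has_integral_integral_lebesgue_on[OF int S]]) (simp add: p_def)
  moreover have "(\<integral>\<^sup>+ t. ennreal (p t) \<partial>lebesgue_on S) = ennreal (integral\<^sup>L (lebesgue_on S) p)"
    using int by (rule nn_integral_eq_integral) (simp add: p_def)
  ultimately show ?thesis
    by (simp add: p_nn ennreal_leI)
qed simp

lemma AE_lebesgue_on_open_interval: "AE t in lebesgue_on {0..1}. t \<in> {0<..<1::real}"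
proof -
  have "AE t in lebesgue. t \<noteq> c" for c :: real
    by (rule AE_completion) (rule AE_lborel_singleton)
  from this[of 0] this[of 1] have "AE t in lebesgue. t \<in> {0..1} \<longrightarrow> t \<in> {0<..<1::real}"
    by eventually_elim auto
  then show ?thesis by (subst AE_restrict_space_iff) (simp, assumption)
qed

text \<open>Dividing the convexity inequality by \<open>r\<close> and letting \<open>r\<close> tend
  to 0 gives a tangent inequality with a quadratic gain; its instances at \<open>s\<close> and at
  \<open>t\<close> are added.\<close>

lemma strongly_convex_imp_derivative_mono:
  fixes h h' :: "real \<Rightarrow> real"
  assumes deriv: "\<And>t. t \<in> I \<Longrightarrow> (h has_real_derivative h' t) (at t within I)"
    and I: "convex I"
    and conv: "\<And>s t r. s \<in> I \<Longrightarrow> t \<in> I \<Longrightarrow> r \<in> {0..1} \<Longrightarrow>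
      h (s + r * (t - s)) \<le> (1 - r) * h s + r * h t - K / 2 * r * (1 - r) * (t - s)\<^sup>2"
    and st: "s \<in> I" "t \<in> I"
  shows "K * (t - s)\<^sup>2 \<le> (t - s) * (h' t - h' s)"
proof -
  have tangent: "h' s * (t - s) \<le> h t - h s - K / 2 * (t - s)\<^sup>2" if "s \<in> I" "t \<in> I" for s t
  proof -
    define \<phi> where "\<phi> r = s + r * (t - s)" for r
    have "\<phi> r \<in> I" if "r \<in> {0..1}" for r
      using convexD[OF I \<open>s \<in> I\<close> \<open>t \<in> I\<close>, of "1 - r" r] that by (simp add: \<phi>_def algebra_simps)
    then have "(h has_real_derivative h' (\<phi> 0)) (at (\<phi> 0) within \<phi> ` {0..1})"
      by (intro DERIV_subset[OF deriv]) auto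
    then have "(h \<circ> \<phi> has_real_derivative h' (\<phi> 0) * (t - s)) (at 0 within {0..1})"
      by (rule DERIV_image_chain) (auto simp: \<phi>_def intro!: derivative_eq_intros)
    then have lim: "((\<lambda>r. (h (\<phi> r) - h s) / r) \<longlongrightarrow> h' s * (t - s)) (at 0 within {0..1})"
      by (simp add: has_field_derivative_iff \<phi>_def)
    have "((\<lambda>r. h t - h s - K / 2 * (1 - r) * (t - s)\<^sup>2) \<longlongrightarrow> h t - h s - K / 2 * (1 - 0) * (t - s)\<^sup>2)
        (at 0 within {0..1})"
      by (intro tendsto_intros)
    moreover have "eventually (\<lambda>r. (h (\<phi> r) - h s) / r \<le> h t - h s - K / 2 * (1 - r) * (t - s)\<^sup>2)
        (at 0 within {0..1})"
      unfolding eventually_at_filter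
    proof (intro always_eventually allI impI)
      fix r :: real assume "r \<noteq> 0" "r \<in> {0..1}"
      then have "0 < r" by simp
      moreover have "h (\<phi> r) - h s \<le> (h t - h s - K / 2 * (1 - r) * (t - s)\<^sup>2) * r"
        using conv[OF that \<open>r \<in> {0..1}\<close>] by (simp add: \<phi>_def algebra_simps)
      ultimately show "(h (\<phi> r) - h s) / r \<le> h t - h s - K / 2 * (1 - r) * (t - s)\<^sup>2"
        by (simp only: pos_divide_le_eq)
    qed
    ultimately show ?thesis
      using tendsto_le[OF _ _ lim] by (fastforce simp: at_within_Icc_at_right trivial_limit_at_right_real)
  qed
  from tangent[OF st] tangent[OF st(2,1)] show ?thesis
    by (simp add: algebra_simps power2_eq_square)
qed

lemma derivative_ge_of_strong_mono:
  fixes g :: "real \<Rightarrow> real"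
  assumes deriv: "(g has_real_derivative d) (at 0 within {0..T})" and "0 < T"
    and mono: "\<And>t. t \<in> {0..T} \<Longrightarrow> K * t\<^sup>2 \<le> t * (g t - g 0)"
  shows "K \<le> d"
proof (rule tendsto_lowerbound)
  show "((\<lambda>t. (g t - g 0) / t) \<longlongrightarrow> d) (at 0 within {0..T})"
    using deriv by (simp add: has_field_derivative_iff)
  show "eventually (\<lambda>t. K \<le> (g t - g 0) / t) (at 0 within {0..T})"
    unfolding eventually_at_filter
  proof (intro always_eventually allI impI)
    fix t assume "t \<noteq> 0" "t \<in> {0..T}"
    with mono[of t] show "K \<le> (g t - g 0) / t"
      by (simp add: pos_le_divide_eq power2_eq_square)
  qed
  show "at 0 within {0..T} \<noteq> bot"
    using \<open>0 < T\<close> by (simp add: at_within_Icc_at_right)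
qed

text \<open>Hamilton's equations for the Hamiltonian \<open>action / 2\<close> in the variables \<open>\<rho>\<close> and \<open>f\<close>, that is,
  the geodesic equations of the transport metric.\<close>

definition geodesic_flow ::
  "('a::finite \<Rightarrow> 'a \<Rightarrow> real) \<Rightarrow> real set \<Rightarrow> (real \<Rightarrow> 'a \<Rightarrow> real) \<Rightarrow> (real \<Rightarrow> 'a \<Rightarrow> real) \<Rightarrow> bool" where
  "geodesic_flow Q S \<rho> f \<longleftrightarrow> (\<forall>t\<in>S. \<forall>x. 0 < \<rho> t x \<and>
     ((\<lambda>s. \<rho> s x) has_real_derivative velocity Q (\<rho> t) (f t) x) (at t within S) \<and>
     ((\<lambda>s. f s x) has_real_derivative force Q (\<rho> t) (f t) x) (at t within S))"

lemma geodesic_flowD: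
  assumes "geodesic_flow Q S \<rho> f" "t \<in> S"
  shows "0 < \<rho> t x"
    "((\<lambda>s. \<rho> s x) has_real_derivative velocity Q (\<rho> t) (f t) x) (at t within S)"
    "((\<lambda>s. f s x) has_real_derivative force Q (\<rho> t) (f t) x) (at t within S)"
  using assms by (auto simp: geodesic_flow_def)

section \<open>Scaling and reparametrisation of the flow\<close>

lemma velocity_cmult: "velocity Q \<rho> (\<lambda>x. c * f x) x = c * velocity Q \<rho> f x"
  by (simp add: velocity_eq sum_distrib_left right_diff_distrib[symmetric] mult_ac)

lemma force_cmult: "force Q \<rho> (\<lambda>x. c * f x) x = c\<^sup>2 * force Q \<rho> f x"
  by (simp add: force_def sum_distrib_left right_diff_distrib[symmetric] power_mult_distrib mult_ac)

lemma action_cmult: "action Q \<pi> \<rho> (\<lambda>x. c * f x) = c\<^sup>2 * action Q \<pi> \<rho> f"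
  by (simp add: action_def sum_distrib_left right_diff_distrib[symmetric] power_mult_distrib mult_ac)

text \<open>Velocity is linear and force quadratic in \<open>f\<close>, so a change of time by the
  factor \<open>t - s\<close> is matched by scaling \<open>f\<close> with the same factor. Reversed
  time, \<open>t < s\<close>, is included.\<close>

lemma geodesic_flow_affine:
  assumes flow: "geodesic_flow Q I \<rho> f" and I: "convex I" "s \<in> I" "t \<in> I"
  shows "geodesic_flow Q {0..1} (\<lambda>r. \<rho> (s + r * (t - s))) (\<lambda>r x. (t - s) * f (s + r * (t - s)) x)"
  unfolding geodesic_flow_def
proof (intro ballI allI conjI)
  fix r :: real and x assume r: "r \<in> {0..1}"
  define \<phi> where "\<phi> r = s + r * (t - s)" for r
  have \<phi>: "\<phi> r \<in> I" if "r \<in> {0..1}" for r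
    using convexD[OF I, of "1 - r" r] that by (simp add: \<phi>_def algebra_simps)
  note flowD = geodesic_flowD[OF flow \<phi>[OF r], of x]
  show "0 < \<rho> (s + r * (t - s)) x"
    using flowD(1) by (simp add: \<phi>_def)
  have chain: "((\<lambda>r. g (\<phi> r)) has_real_derivative g' * (t - s)) (at r within {0..1})"
    if "(g has_real_derivative g') (at (\<phi> r) within I)" for g g'
  proof -
    have "(g has_real_derivative g') (at (\<phi> r) within \<phi> ` {0..1})"
      using that by (rule DERIV_subset) (use \<phi> in auto)
    then have "(g \<circ> \<phi> has_real_derivative g' * (t - s)) (at r within {0..1})"
      by (rule DERIV_image_chain) (auto simp: \<phi>_def intro!: derivative_eq_intros)
    then show ?thesis by (simp add: o_def)
  qed
  show "((\<lambda>r. \<rho> (s + r * (t - s)) x) has_real_derivative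
      velocity Q (\<rho> (s + r * (t - s))) (\<lambda>x. (t - s) * f (s + r * (t - s)) x) x) (at r within {0..1})"
    using chain[OF flowD(2)] by (simp add: \<phi>_def velocity_cmult mult.commute)
  show "((\<lambda>r. (t - s) * f (s + r * (t - s)) x) has_real_derivative
      force Q (\<rho> (s + r * (t - s))) (\<lambda>x. (t - s) * f (s + r * (t - s)) x) x) (at r within {0..1})"
    using DERIV_cmult[OF chain[OF flowD(3)], of "t - s"]
    by (simp add: \<phi>_def force_cmult power2_eq_square mult_ac)
qed

section \<open>Conservation laws, minimality and convexity along the flow\<close>

context reversible_chain
begin

text \<open>Conservation of energy for Hamilton's equations.\<close>

lemma geodesic_flow_action_const:
  assumes flow: "geodesic_flow Q I \<rho> f" and I: "convex I" "s \<in> I" "t \<in> I"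
  shows "action Q \<pi> (\<rho> s) (f s) = action Q \<pi> (\<rho> t) (f t)"
proof -
  have "((\<lambda>t. action Q \<pi> (\<rho> t) (f t)) has_real_derivative 0) (at r within I)" if "r \<in> I" for r
    using action_has_real_derivative[of \<rho> _ r I f, OF geodesic_flowD(2)[OF flow that]
        geodesic_flowD(3)[OF flow that] geodesic_flowD(1)[OF flow] that]
    by (simp add: mult.commute)
  then obtain c where "\<forall>r\<in>I. action Q \<pi> (\<rho> r) (f r) = c"
    using has_field_derivative_zero_constant[OF I(1)] by blast
  with I show ?thesis by simp
qed

text \<open>Conservation of mass: the velocity pairs to zero with the constant function 1, whose
  gradient vanishes.\<close>

lemma geodesic_flow_density:
  assumes flow: "geodesic_flow Q I \<rho> f" and I: "convex I" "s \<in> I" "t \<in> I"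
    and "\<rho> s \<in> densities \<pi>"
  shows "\<rho> t \<in> densities \<pi>"
proof -
  have "((\<lambda>t. \<Sum>x\<in>UNIV. \<pi> x * \<rho> t x) has_real_derivative (\<Sum>x\<in>UNIV. \<pi> x * velocity Q (\<rho> r) (f r) x)) (at r within I)"
    if "r \<in> I" for r
    using geodesic_flowD(2)[OF flow that] by (intro DERIV_sum DERIV_cmult)
  moreover have "(\<Sum>x\<in>UNIV. \<pi> x * velocity Q (\<rho> r) (f r) x) = 0" for r
    using sum_velocity[of "\<lambda>_. 1" "\<rho> r" "f r"] by (simp add: edge_sum_def mult.commute)
  ultimately have "((\<lambda>t. \<Sum>x\<in>UNIV. \<pi> x * \<rho> t x) has_real_derivative 0) (at r within I)"
    if "r \<in> I" for r
    using that by simp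
  then obtain c where "\<forall>r\<in>I. (\<Sum>x\<in>UNIV. \<pi> x * \<rho> r x) = c"
    using has_field_derivative_zero_constant[OF I(1)] by blast
  with assms geodesic_flowD(1)[OF flow] show ?thesis
    by (auto simp: densities_def intro: less_imp_le)
qed

text \<open>The velocity contributes the full action to the derivative of the pairing and the force
  removes half of it, by Euler's identity; the action is constant in time. So the calibration bound
  is attained along the flow itself.\<close>

lemma geodesic_flow_pairing:
  assumes flow: "geodesic_flow Q {0..1} \<rho> f"
  shows "2 * ((\<Sum>x\<in>UNIV. f 1 x * \<rho> 1 x * \<pi> x) - (\<Sum>x\<in>UNIV. f 0 x * \<rho> 0 x * \<pi> x))
    = action Q \<pi> (\<rho> 0) (f 0)"
proof -
  define \<psi> where "\<psi> t = (\<Sum>x\<in>UNIV. f t x * \<rho> t x * \<pi> x)" for t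
  have "(\<psi> has_real_derivative action Q \<pi> (\<rho> 0) (f 0) / 2) (at t within {0..1})"
    if t: "t \<in> {0..1}" for t
  proof -
    have "(\<psi> has_real_derivative
        (\<Sum>x\<in>UNIV. (f t x * velocity Q (\<rho> t) (f t) x + force Q (\<rho> t) (f t) x * \<rho> t x) * \<pi> x)) (at t within {0..1})"
      unfolding \<psi>_def by (intro DERIV_sum DERIV_cmult_right DERIV_mult' geodesic_flowD(2,3)[OF flow t])
    moreover have "(\<Sum>x\<in>UNIV. (f t x * velocity Q (\<rho> t) (f t) x + force Q (\<rho> t) (f t) x * \<rho> t x) * \<pi> x)
        = action Q \<pi> (\<rho> t) (f t) / 2"
      using action_eq_sum_force[of "\<rho> t" "f t"] action_eq_sum_velocity[of "\<rho> t" "f t"] geodesic_flowD(1)[OF flow t]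
      by (simp add: distrib_right sum.distrib mult.commute[of "\<rho> t x" for x])
    ultimately show ?thesis
      using geodesic_flow_action_const[OF flow _ t, of 0] by simp
  qed
  then have "((\<lambda>t. action Q \<pi> (\<rho> 0) (f 0) / 2) has_integral (\<psi> 1 - \<psi> 0)) {0..1::real}"
    unfolding has_real_derivative_iff_has_vector_derivative
    by (intro fundamental_theorem_of_calculus) simp_all
  from has_integral_unique[OF this has_integral_const_real]
  show ?thesis by (simp add: \<psi>_def)
qed

text \<open>The momentum \<open>f\<close> of the flow is a calibration: along any competitor
  \<open>\<sigma>\<close>, the pairing of \<open>f\<close> with \<open>\<sigma>\<close> grows at most at half the rate of the action.\<close>

lemma geodesic_flow_action_le:
  assumes flow: "geodesic_flow Q {0..1} \<rho> f"
    and comp: "(\<sigma>, g) \<in> continuity_eq_curves Q \<pi> (\<rho> 0) (\<rho> 1)"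
  shows "ennreal (action Q \<pi> (\<rho> 0) (f 0)) \<le>
    (\<integral>\<^sup>+ t. ennreal (action Q \<pi> (\<sigma> t) (g t)) \<partial>lebesgue_on {0..1})"
proof -
  define \<Psi> where "\<Psi> t = 2 * (\<Sum>x\<in>UNIV. f t x * \<sigma> t x * \<pi> x)" for t
  define \<Psi>' where "\<Psi>' t = vector_derivative \<Psi> (at t)" for t
  have at: "at t within {0..1} = at t" if "t \<in> {0<..<1}" for t :: real
    using that by (intro at_within_interior) auto
  have f_deriv: "((\<lambda>s. f s x) has_real_derivative force Q (\<rho> t) (f t) x) (at t)" if "t \<in> {0<..<1}" for t x
    using geodesic_flowD(3)[OF flow, of t x] at that by auto
  have \<Psi>_deriv: "(\<Psi> has_real_derivative
      2 * (\<Sum>x\<in>UNIV. (f t x * d x + force Q (\<rho> t) (f t) x * \<sigma> t x) * \<pi> x)) (at t)"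
    if "t \<in> {0<..<1}" "\<And>x. ((\<lambda>s. \<sigma> s x) has_real_derivative d x) (at t)" for t d
    unfolding \<Psi>_def
    by (intro DERIV_cmult DERIV_sum DERIV_cmult_right DERIV_mult' that f_deriv)
  have "\<forall>x. \<exists>S. finite S \<and> (\<lambda>t. \<sigma> t x) C1_differentiable_on ({0..1} - S)"
    and \<sigma>_cont: "\<And>x. continuous_on {0..1} (\<lambda>t. \<sigma> t x)"
    using comp by (auto simp: continuity_eq_curves_def piecewise_C1_differentiable_on_def)
  then obtain S where S: "\<And>x. finite (S x)" "\<And>x. (\<lambda>t. \<sigma> t x) C1_differentiable_on ({0..1} - S x)"
    by metis
  \<comment> \<open>A competitor is differentiable off the finite union of the exceptional sets of
    its coordinates, and the fundamental theorem tolerates these points.\<close>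
  have "(\<Psi>' has_integral (\<Psi> 1 - \<Psi> 0)) {0..1}"
  proof (rule fundamental_theorem_of_calculus_interior_strong)
    show "finite (\<Union>x. S x)" using S(1) by auto
    have f_cont: "continuous_on {0..1} (\<lambda>t. f t x)" for x
      using geodesic_flowD(3)[OF flow] by (rule DERIV_continuous_on)
    show "continuous_on {0..1} \<Psi>"
      unfolding \<Psi>_def by (intro continuous_intros f_cont \<sigma>_cont)
    fix t assume t: "t \<in> {0<..<1} - (\<Union>x. S x)"
    have "\<exists>d. ((\<lambda>s. \<sigma> s x) has_real_derivative d) (at t)" for x
    proof -
      obtain D where "\<forall>s\<in>{0..1} - S x. ((\<lambda>s. \<sigma> s x) has_vector_derivative D s) (at s)"
        using S(2)[of x] by (auto simp: C1_differentiable_on_def)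
      then show ?thesis using t by (auto simp: has_real_derivative_iff_has_vector_derivative)
    qed
    then have "\<exists>d. \<forall>x. ((\<lambda>s. \<sigma> s x) has_real_derivative d x) (at t)"
      by (intro choice) blast
    then obtain d where "\<forall>x. ((\<lambda>s. \<sigma> s x) has_real_derivative d x) (at t)" ..
    with \<Psi>_deriv[of t d] t have "\<Psi> differentiable (at t)"
      by (auto intro: differentiableI_vector simp: has_real_derivative_iff_has_vector_derivative)
    then show "(\<Psi> has_vector_derivative \<Psi>' t) (at t)"
      by (simp add: \<Psi>'_def vector_derivative_works)
  qed simp
  then have "ennreal (\<Psi> 1 - \<Psi> 0) \<le> (\<integral>\<^sup>+ t. ennreal (\<Psi>' t) \<partial>lebesgue_on {0..1})"
    by (rule has_integral_le_nn_integral) simp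
  \<comment> \<open>For almost every \<open>t\<close> the continuity equation identifies the
    derivative of \<open>\<sigma>\<close>, so the calibration bound applies; the factor 2 in
    \<open>\<Psi>\<close> absorbs its one half.\<close>
  also have "\<dots> \<le> (\<integral>\<^sup>+ t. ennreal (action Q \<pi> (\<sigma> t) (g t)) \<partial>lebesgue_on {0..1})"
  proof (rule nn_integral_mono_AE)
    have "AE t in lebesgue_on {0..1}. \<forall>x. ((\<lambda>s. \<sigma> s x) has_real_derivative velocity Q (\<sigma> t) (g t) x) (at t)"
      using comp by (auto simp: continuity_eq_curves_def velocity_def)
    then show "AE t in lebesgue_on {0..1}. ennreal (\<Psi>' t) \<le> ennreal (action Q \<pi> (\<sigma> t) (g t))"
      using AE_lebesgue_on_open_interval
    proof eventually_elim
      case (elim t)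
      from \<Psi>_deriv[OF elim(2)] elim(1) have "\<Psi>' t =
          2 * (\<Sum>x\<in>UNIV. (f t x * velocity Q (\<sigma> t) (g t) x + force Q (\<rho> t) (f t) x * \<sigma> t x) * \<pi> x)"
        unfolding \<Psi>'_def has_real_derivative_iff_has_vector_derivative
        by (intro vector_derivative_at) auto
      moreover have "\<sigma> t \<in> densities \<pi>"
        using comp elim(2) by (auto simp: continuity_eq_curves_def)
      ultimately show ?case
        using calibration_bound[of "\<rho> t" "\<sigma> t" "f t" "g t"] geodesic_flowD(1)[OF flow, of t] elim(2)
        by (intro ennreal_leI) (auto simp: densities_def mult.commute[of "\<sigma> t x" for x])
    qed
  qed
  also have "\<Psi> 1 - \<Psi> 0 = action Q \<pi> (\<rho> 0) (f 0)"
    using geodesic_flow_pairing[OF flow] comp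
    by (simp add: \<Psi>_def continuity_eq_curves_def right_diff_distrib)
  finally show ?thesis .
qed

lemma geodesic_flow_in_continuity_eq_curves:
  assumes flow: "geodesic_flow Q {0..1} \<rho> f" and dens: "\<rho> 0 \<in> densities \<pi>"
  shows "(\<rho>, f) \<in> continuity_eq_curves Q \<pi> (\<rho> 0) (\<rho> 1)"
proof -
  have at: "at t within {0..1} = at t" if "t \<in> {0<..<1}" for t :: real
    using that by (intro at_within_interior) auto
  have deriv: "((\<lambda>s. \<rho> s x) has_real_derivative velocity Q (\<rho> t) (f t) x) (at t)" if "t \<in> {0<..<1}" for t x
    using geodesic_flowD(2)[OF flow, of t x] at that by auto
  have \<rho>_cont: "continuous_on {0..1} (\<lambda>t. \<rho> t x)" and f_cont: "continuous_on {0..1} (\<lambda>t. f t x)" for x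
    by (rule DERIV_continuous_on, erule geodesic_flowD[OF flow])+
  have hat_cont: "continuous_on {0..1} (\<lambda>t. rho_hat (\<rho> t) x y)" for x y
  proof -
    have "continuous_on {0..1} (\<lambda>t. \<rho> t y * exp_moment 0 (ln (\<rho> t x) - ln (\<rho> t y)))"
      using geodesic_flowD(1)[OF flow]
      by (intro continuous_intros \<rho>_cont) (auto simp: less_imp_neq[symmetric])
    then show ?thesis
      by (rule continuous_on_eq)
        (auto simp: rho_hat_def log_mean_eq_exp_moment geodesic_flowD(1)[OF flow])
  qed
  have "continuous_on {0..1} (\<lambda>t. velocity Q (\<rho> t) (f t) x)" for x
    unfolding velocity_eq by (intro continuous_intros hat_cont f_cont)
  \<comment> \<open>The endpoints are made exceptional because the flow has only one-sided
    derivatives there.\<close>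
  then have "(\<lambda>t. \<rho> t x) C1_differentiable_on {0..1} - {0, 1}" for x
    unfolding C1_differentiable_on_def using deriv
    by (intro exI[of _ "\<lambda>t. velocity Q (\<rho> t) (f t) x"])
      (auto simp: has_real_derivative_iff_has_vector_derivative[symmetric] intro: continuous_on_subset)
  then have "(\<lambda>t. \<rho> t x) piecewise_C1_differentiable_on {0..1}" for x
    unfolding piecewise_C1_differentiable_on_def using \<rho>_cont by (intro conjI exI[of _ "{0, 1}"]) auto
  moreover have "(\<lambda>t. f t x) \<in> borel_measurable (lebesgue_on {0..1})" for x
    using f_cont by (intro continuous_imp_measurable_on_sets_lebesgue) auto
  moreover have "AE t in lebesgue_on {0..1}. \<forall>x. ((\<lambda>s. \<rho> s x) has_real_derivative
      - diverg Q (\<lambda>y z. rho_hat (\<rho> t) y z * grad (f t) y z) x) (at t)"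
    using AE_lebesgue_on_open_interval
    by eventually_elim (use deriv in \<open>auto simp: velocity_def\<close>)
  moreover have "\<rho> t \<in> densities \<pi>" if "t \<in> {0..1}" for t
    using that by (intro geodesic_flow_density[OF flow _ _ _ dens]) auto
  ultimately show ?thesis
    unfolding continuity_eq_curves_def by simp
qed

text \<open>The flow is itself a competitor with constant action, and the calibration shows that no
  competitor does better.\<close>

lemma transport_dist_geodesic_flow_unit:
  assumes flow: "geodesic_flow Q {0..1} \<rho> f" and dens: "\<rho> 0 \<in> densities \<pi>"
  shows "transport_dist Q \<pi> (\<rho> 0) (\<rho> 1) = sqrt (action Q \<pi> (\<rho> 0) (f 0))"
proof -
  have "(INF (\<sigma>, g)\<in>continuity_eq_curves Q \<pi> (\<rho> 0) (\<rho> 1).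
      \<integral>\<^sup>+ t. ennreal (action Q \<pi> (\<sigma> t) (g t)) \<partial>lebesgue_on {0..1}) = ennreal (action Q \<pi> (\<rho> 0) (f 0))"
  proof (rule antisym)
    have "(\<integral>\<^sup>+ t. ennreal (action Q \<pi> (\<rho> t) (f t)) \<partial>lebesgue_on {0..1}) =
        (\<integral>\<^sup>+ t. ennreal (action Q \<pi> (\<rho> 0) (f 0)) \<partial>lebesgue_on {0..1::real})"
    proof (rule nn_integral_cong)
      fix t :: real assume "t \<in> space (lebesgue_on {0..1})"
      then show "ennreal (action Q \<pi> (\<rho> t) (f t)) = ennreal (action Q \<pi> (\<rho> 0) (f 0))"
        using geodesic_flow_action_const[OF flow, of t 0] by simp
    qed
    also have "\<dots> = ennreal (action Q \<pi> (\<rho> 0) (f 0))"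
      by (simp add: emeasure_restrict_space)
    finally show "(INF (\<sigma>, g)\<in>continuity_eq_curves Q \<pi> (\<rho> 0) (\<rho> 1).
        \<integral>\<^sup>+ t. ennreal (action Q \<pi> (\<sigma> t) (g t)) \<partial>lebesgue_on {0..1}) \<le> ennreal (action Q \<pi> (\<rho> 0) (f 0))"
      by (intro INF_lower2[OF geodesic_flow_in_continuity_eq_curves[OF assms]]) simp
  qed (auto intro!: INF_greatest geodesic_flow_action_le[OF flow])
  moreover have "0 \<le> action Q \<pi> (\<rho> 0) (f 0)"
    using geodesic_flowD(1)[OF flow, of 0] by (intro action_nonneg less_imp_le) auto
  ultimately show ?thesis
    unfolding transport_dist_def by (simp only: enn2real_ennreal)
qed

lemma transport_dist_geodesic_flow:
  assumes flow: "geodesic_flow Q I \<rho> f" and I: "convex I" "s \<in> I" "t \<in> I" "r \<in> I"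
    and "\<rho> r \<in> densities \<pi>"
  shows "transport_dist Q \<pi> (\<rho> s) (\<rho> t) = \<bar>t - s\<bar> * sqrt (action Q \<pi> (\<rho> r) (f r))"
proof -
  have dens: "\<rho> s \<in> densities \<pi>"
    by (rule geodesic_flow_density[OF flow I(1,4,2) assms(6)])
  have "transport_dist Q \<pi> (\<rho> s) (\<rho> t) = sqrt ((t - s)\<^sup>2 * action Q \<pi> (\<rho> s) (f s))"
    using transport_dist_geodesic_flow_unit[OF geodesic_flow_affine[OF flow I(1-3)]] dens
    by (simp add: action_cmult)
  also have "\<dots> = \<bar>t - s\<bar> * sqrt (action Q \<pi> (\<rho> s) (f s))"
    by (simp add: real_sqrt_mult)
  also have "action Q \<pi> (\<rho> s) (f s) = action Q \<pi> (\<rho> r) (f r)"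
    by (rule geodesic_flow_action_const[OF flow I(1,2,4)])
  finally show ?thesis .
qed

text \<open>Every segment of the flow, rescaled to unit time, is a constant speed geodesic, so the
  curvature hypothesis applies to it.\<close>

lemma geodesic_flow_entropy_convex:
  assumes flow: "geodesic_flow Q I \<rho> f" and I: "convex I" "s \<in> I" "t \<in> I" "r \<in> I"
    and dens: "\<rho> r \<in> densities \<pi>" and Ric: "entropic_Ric_ge Q \<pi> \<kappa>" and "u \<in> {0..1}"
  shows "rel_entropy \<pi> (\<rho> (s + u * (t - s))) \<le> (1 - u) * rel_entropy \<pi> (\<rho> s) + u * rel_entropy \<pi> (\<rho> t)
    - \<kappa> * action Q \<pi> (\<rho> r) (f r) / 2 * u * (1 - u) * (t - s)\<^sup>2"
proof -
  define \<phi> where "\<phi> u = s + u * (t - s)" for u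
  have \<phi>: "\<phi> u \<in> I" if "u \<in> {0..1}" for u
    using convexD[OF I(1-3), of "1 - u" u] that by (simp add: \<phi>_def algebra_simps)
  define a where "a = action Q \<pi> (\<rho> r) (f r)"
  have "0 \<le> a"
    unfolding a_def using geodesic_flowD(1)[OF flow \<open>r \<in> I\<close>] by (intro action_nonneg less_imp_le) auto
  have dist: "transport_dist Q \<pi> (\<rho> (\<phi> u)) (\<rho> (\<phi> v)) = \<bar>u - v\<bar> * (\<bar>t - s\<bar> * sqrt a)"
    if "u \<in> {0..1}" "v \<in> {0..1}" for u v
    unfolding transport_dist_geodesic_flow[OF flow I(1) \<phi>[OF that(1)] \<phi>[OF that(2)] I(4) dens] a_def
    by (simp add: \<phi>_def left_diff_distrib[symmetric] abs_mult abs_minus_commute)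
  have "const_speed_geodesic Q \<pi> (\<lambda>u. \<rho> (\<phi> u))"
    unfolding const_speed_geodesic_def
    using geodesic_flow_density[OF flow I(1,4) \<phi> dens] by (auto simp: dist)
  with Ric \<open>u \<in> {0..1}\<close> have "rel_entropy \<pi> (\<rho> (\<phi> u)) \<le> (1 - u) * rel_entropy \<pi> (\<rho> (\<phi> 0)) + u * rel_entropy \<pi> (\<rho> (\<phi> 1))
        - \<kappa> / 2 * u * (1 - u) * (transport_dist Q \<pi> (\<rho> (\<phi> 0)) (\<rho> (\<phi> 1)))\<^sup>2"
    unfolding entropic_Ric_ge_def by blast
  moreover have "(transport_dist Q \<pi> (\<rho> (\<phi> 0)) (\<rho> (\<phi> 1)))\<^sup>2 = (t - s)\<^sup>2 * a"
    using dist[of 0 1] \<open>0 \<le> a\<close> by (simp add: power_mult_distrib)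
  ultimately show ?thesis
    by (simp add: \<phi>_def mult_ac flip: a_def)
qed

text \<open>Strong convexity of the entropy along the flow makes its first derivative
  \<open>h'\<close> strongly monotone; the derivative of \<open>h'\<close> at time 0 is the Hessian,
  after self-adjointness moves the Laplacian from the force to the density.\<close>

lemma geodesic_flow_hessian_bound:
  assumes flow: "geodesic_flow Q {0..T} \<rho> f" and "0 < T"
    and dens: "\<rho> 0 \<in> densities \<pi>" and Ric: "entropic_Ric_ge Q \<pi> \<kappa>"
  shows "\<kappa> * action Q \<pi> (\<rho> 0) (f 0) \<le> entropy_hessian Q \<pi> (\<rho> 0) (f 0)"
proof -
  define h' where "h' t = - (\<Sum>x\<in>UNIV. \<rho> t x * laplace Q (f t) x * \<pi> x)" for t
  have "((\<lambda>t. rel_entropy \<pi> (\<rho> t)) has_real_derivative h' t) (at t within {0..T})" if "t \<in> {0..T}" for t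
    unfolding h'_def using geodesic_flowD[OF flow that] by (intro rel_entropy_has_real_derivative)
  from strongly_convex_imp_derivative_mono[OF this _ geodesic_flow_entropy_convex[OF flow _ _ _ _ dens Ric]]
  have mono: "\<kappa> * action Q \<pi> (\<rho> 0) (f 0) * t\<^sup>2 \<le> t * (h' t - h' 0)" if "t \<in> {0..T}" for t
    using that \<open>0 < T\<close> by fastforce
  have "((\<lambda>t. laplace Q (f t) x) has_real_derivative laplace Q (force Q (\<rho> 0) (f 0)) x) (at 0 within {0..T})" for x
    unfolding laplace_def using \<open>0 < T\<close>
    by (intro DERIV_sum DERIV_cmult_right DERIV_diff geodesic_flowD(3)[OF flow]) auto
  then have "(h' has_real_derivative - (\<Sum>x\<in>UNIV. (\<rho> 0 x * laplace Q (force Q (\<rho> 0) (f 0)) x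
      + velocity Q (\<rho> 0) (f 0) x * laplace Q (f 0) x) * \<pi> x)) (at 0 within {0..T})"
    unfolding h'_def[abs_def] using \<open>0 < T\<close>
    by (intro DERIV_minus DERIV_sum DERIV_cmult_right DERIV_mult' geodesic_flowD(2)[OF flow]) auto
  also have "- (\<Sum>x\<in>UNIV. (\<rho> 0 x * laplace Q (force Q (\<rho> 0) (f 0)) x
      + velocity Q (\<rho> 0) (f 0) x * laplace Q (f 0) x) * \<pi> x) = entropy_hessian Q \<pi> (\<rho> 0) (f 0)"
    unfolding entropy_hessian_def distrib_right sum.distrib laplace_self_adjoint[of "\<rho> 0"]
    by (simp add: mult_ac)
  finally show ?thesis
    using derivative_ge_of_strong_mono \<open>0 < T\<close> mono by blast
qed

end

subsection \<open>The gradient estimate for the heat semigroup\<close>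

text \<open>In the coordinates \<open>ln \<rho>\<close> and \<open>f\<close> the flow is given by a smooth vector field on a whole
  Euclidean space, so that positivity of \<open>\<rho>\<close> need not be controlled.\<close>

lemma geodesic_flow_exists:
  fixes \<rho>0 f0 :: "'a::finite \<Rightarrow> real"
  assumes "\<And>x. 0 < \<rho>0 x"
  obtains T \<rho> f where "0 < T" "geodesic_flow Q {0..T} \<rho> f" "\<rho> 0 = \<rho>0" "f 0 = f0"
proof -
  \<comment> \<open>The first component is the velocity divided by the density, that is, the
    derivative of \<open>ln \<rho>\<close>; the second is the force. Differences, the square and the
    factor one half are spelled so that the closure rules collected in \<open>lip\<close> match
    syntactically.\<close>
  define F :: "(real ^ 'a) \<times> (real ^ 'a) \<Rightarrow> (real ^ 'a) \<times> (real ^ 'a)" where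
    "F z = (let u = (\<lambda>x. fst z $ x); f = (\<lambda>x. snd z $ x) in
      (\<chi> x. - (\<Sum>y\<in>UNIV. exp_moment 0 (u x + - u y) * exp (u y + - u x) * (f y + - f x) * Q x y),
       \<chi> x. - (\<Sum>y\<in>UNIV. (f y + - f x) * (f y + - f x) *
         (exp (u y + - u x) * exp_moment (Suc 0) (u x + - u y)) * Q x y) * (1 / 2)))" for z
  define z0 :: "(real ^ 'a) \<times> (real ^ 'a)" where "z0 = (\<chi> x. ln (\<rho>0 x), \<chi> x. f0 x)"
  have lin: "bounded_linear (\<lambda>z :: (real ^ 'a) \<times> (real ^ 'a). fst z $ x)"
    "bounded_linear (\<lambda>z :: (real ^ 'a) \<times> (real ^ 'a). snd z $ x)" for x
    by (rule bounded_linear_compose[OF bounded_linear_vec_nth bounded_linear_fst]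
        bounded_linear_compose[OF bounded_linear_vec_nth bounded_linear_snd])+
  have coord: "lipschitz_bounded_on (cball z0 1) (\<lambda>z. fst z $ x)" "lipschitz_bounded_on (cball z0 1) (\<lambda>z. snd z $ x)" for x
    by (auto intro!: lipschitz_bounded_on_linear lin)
  have exp_lip: "lipschitz_bounded_on S (\<lambda>x. exp (g x))" if "lipschitz_bounded_on S g" for S g
    using that by (rule lipschitz_bounded_on_compose[where h' = exp]) (auto intro!: derivative_eq_intros continuous_intros)
  have moment_lip: "lipschitz_bounded_on S (\<lambda>x. exp_moment n (g x))" if "lipschitz_bounded_on S g" for S g n
    using that by (rule lipschitz_bounded_on_compose[where h' = "exp_moment (Suc n)"])
      (auto intro!: derivative_eq_intros continuous_intros)
  note lip = lipschitz_bounded_on_const lipschitz_bounded_on_add lipschitz_bounded_on_minus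
    lipschitz_bounded_on_mult lipschitz_bounded_on_sum exp_lip moment_lip coord
  obtain L where "L-lipschitz_on (cball z0 1) F"
  proof (rule lipschitz_on_vec_pairI)
    show "lipschitz_bounded_on (cball z0 1) (\<lambda>z. fst (F z) $ x)" for x
      unfolding F_def Let_def fst_conv vec_lambda_beta by (intro lip)
    show "lipschitz_bounded_on (cball z0 1) (\<lambda>z. snd (F z) $ x)" for x
      unfolding F_def Let_def snd_conv vec_lambda_beta by (intro lip)
  qed
  then obtain T z where T: "0 < T" "z 0 = z0"
    and z: "\<And>t. t \<in> {0..T} \<Longrightarrow> (z has_vector_derivative F (z t)) (at t within {0..T})"
    by (rule ode_solution_exists) (rule that)
  define \<rho> where "\<rho> t x = exp (fst (z t) $ x)" for t x
  define f where "f t x = snd (z t) $ x" for t x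
  have "geodesic_flow Q {0..T} \<rho> f"
    unfolding geodesic_flow_def
  proof (intro ballI allI conjI)
    fix t x assume t: "t \<in> {0..T}"
    show "0 < \<rho> t x" by (simp add: \<rho>_def)
    have hat: "rho_hat (\<rho> t) x y = \<rho> t x * (exp_moment 0 (fst (z t) $ x - fst (z t) $ y) * exp (fst (z t) $ y - fst (z t) $ x))" for y
      by (simp add: rho_hat_def log_mean_eq_exp_moment \<rho>_def exp_diff)
    have "((\<lambda>s. fst (z s) $ x) has_real_derivative fst (F (z t)) $ x) (at t within {0..T})"
      unfolding has_real_derivative_iff_has_vector_derivative
      by (rule bounded_linear.has_vector_derivative[OF lin(1) z[OF t]])
    then have "((\<lambda>s. \<rho> s x) has_real_derivative \<rho> t x * fst (F (z t)) $ x) (at t within {0..T})"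
      unfolding \<rho>_def by (rule DERIV_chain2[OF DERIV_exp])
    moreover have "\<rho> t x * fst (F (z t)) $ x = velocity Q (\<rho> t) (f t) x"
    proof -
      have "fst (F (z t)) $ x = - (\<Sum>y\<in>UNIV. exp_moment 0 (fst (z t) $ x - fst (z t) $ y) *
          exp (fst (z t) $ y - fst (z t) $ x) * (f t y - f t x) * Q x y)"
        by (simp add: F_def Let_def f_def)
      then show ?thesis
        by (simp only: velocity_eq hat sum_distrib_left mult_minus_right mult.assoc)
    qed
    ultimately show "((\<lambda>s. \<rho> s x) has_real_derivative velocity Q (\<rho> t) (f t) x) (at t within {0..T})"
      by simp
    have "((\<lambda>s. f s x) has_real_derivative snd (F (z t)) $ x) (at t within {0..T})"
      unfolding has_real_derivative_iff_has_vector_derivative f_def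
      by (rule bounded_linear.has_vector_derivative[OF lin(2) z[OF t]])
    moreover have "snd (F (z t)) $ x = force Q (\<rho> t) (f t) x"
      by (simp add: F_def Let_def force_def f_def \<rho>_def log_mean_deriv_def exp_diff power2_eq_square)
    ultimately show "((\<lambda>s. f s x) has_real_derivative force Q (\<rho> t) (f t) x) (at t within {0..T})"
      by simp
  qed
  moreover have "\<rho> 0 = \<rho>0" "f 0 = f0"
    using T assms by (auto simp: \<rho>_def f_def z0_def)
  ultimately show ?thesis using T(1) by (intro that)
qed

text \<open>A flow started at \<open>(\<rho>, f)\<close> is needed only for a short time, since the
  Hessian is read off at time 0.\<close>

lemma (in reversible_chain) action_le_entropy_hessian:
  assumes "entropic_Ric_ge Q \<pi> \<kappa>" "\<rho> \<in> densities \<pi>" "\<And>x. 0 < \<rho> x"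
  shows "\<kappa> * action Q \<pi> \<rho> f \<le> entropy_hessian Q \<pi> \<rho> f"
proof -
  obtain T r g where flow: "0 < T" "geodesic_flow Q {0..T} r g" and init: "r 0 = \<rho>" "g 0 = f"
    by (rule geodesic_flow_exists[OF assms(3)])
  then show ?thesis
    using geodesic_flow_hessian_bound[OF flow(2,1) _ assms(1)] assms(2) by (simp only: init)
qed

section \<open>The heat semigroup and its gradient estimate\<close>

definition markov_op :: "('a::finite \<Rightarrow> 'a \<Rightarrow> real) \<Rightarrow> ('a \<Rightarrow> real) \<Rightarrow> 'a \<Rightarrow> real" where
  "markov_op Q f x = (\<Sum>y\<in>UNIV. Q x y * f y)"

text \<open>The semigroup generated by \<open>laplace Q\<close>. Splitting off
  \<open>exp (- t)\<close> leaves the exponential series of the Markov operator, whose terms are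
  visibly nonnegative when \<open>f\<close> and \<open>t\<close> are.\<close>

definition heat :: "('a::finite \<Rightarrow> 'a \<Rightarrow> real) \<Rightarrow> real \<Rightarrow> ('a \<Rightarrow> real) \<Rightarrow> 'a \<Rightarrow> real" where
  "heat Q t f x = exp (- t) * (\<Sum>n. (markov_op Q ^^ n) f x / fact n * t ^ n)"

lemma heat_0 [simp]: "heat Q 0 f = f"
  using powser_zero[of "\<lambda>n. (markov_op Q ^^ n) f x / fact n" for x]
  by (simp add: heat_def fun_eq_iff del: powser_zero)

context reversible_chain
begin

lemma laplace_eq_markov_op: "laplace Q f x = markov_op Q f x - f x"
  unfolding laplace_def markov_op_def left_diff_distrib sum_subtractf sum_distrib_left[symmetric]
  by (simp add: Q_sum mult.commute)

lemma markov_op_funpow_bound: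
  assumes "\<And>x. \<bar>f x\<bar> \<le> B"
  shows "\<bar>(markov_op Q ^^ n) f x\<bar> \<le> B"
proof (induction n arbitrary: x)
  case (Suc n)
  have "\<bar>markov_op Q ((markov_op Q ^^ n) f) x\<bar> \<le> (\<Sum>y\<in>UNIV. Q x y * \<bar>(markov_op Q ^^ n) f y\<bar>)"
    unfolding markov_op_def[of Q "(markov_op Q ^^ n) f"] using Q_nonneg by (intro order_trans[OF sum_abs] sum_mono) (simp add: abs_mult)
  also have "\<dots> \<le> (\<Sum>y\<in>UNIV. Q x y * B)"
    using Suc Q_nonneg by (intro sum_mono mult_left_mono) auto
  also have "\<dots> = B"
    using Q_sum by (simp flip: sum_distrib_right)
  finally show ?case by simp
qed (simp add: assms)

lemma markov_op_funpow_nonneg: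
  assumes "\<And>x. 0 \<le> f x"
  shows "0 \<le> (markov_op Q ^^ n) f x"
proof (induction n arbitrary: x)
  case (Suc n)
  then have "0 \<le> markov_op Q ((markov_op Q ^^ n) f) x"
    unfolding markov_op_def[of Q "(markov_op Q ^^ n) f"] by (intro sum_nonneg mult_nonneg_nonneg Q_nonneg)
  then show ?case by simp
qed (simp add: assms)

lemma heat_summable: "summable (\<lambda>n. (markov_op Q ^^ n) f x / fact n * t ^ n)"
proof (rule summable_comparison_test')
  define B where "B = Max (range (\<lambda>x. \<bar>f x\<bar>))"
  have B: "\<bar>f x\<bar> \<le> B" for x by (simp add: B_def)
  show "summable (\<lambda>n. B * (inverse (fact n) * \<bar>t\<bar> ^ n))"
    by (intro summable_mult summable_exp)
  show "norm ((markov_op Q ^^ n) f x / fact n * t ^ n) \<le> B * (inverse (fact n) * \<bar>t\<bar> ^ n)" for n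
    using mult_right_mono[OF markov_op_funpow_bound[of f B n x, OF B], of "inverse (fact n) * \<bar>t\<bar> ^ n"]
    by (simp add: abs_mult power_abs divide_inverse mult.assoc)
qed

lemma laplace_heat: "laplace Q (heat Q t f) x = heat Q t (markov_op Q f) x - heat Q t f x"
proof -
  have "(markov_op Q ^^ n) (markov_op Q f) x = (\<Sum>y\<in>UNIV. Q x y * (markov_op Q ^^ n) f y)" for n
    by (simp add: funpow_swap1[symmetric]) (simp add: markov_op_def)
  then have "heat Q t (markov_op Q f) x = exp (- t) * (\<Sum>n. \<Sum>y\<in>UNIV. Q x y * ((markov_op Q ^^ n) f y / fact n * t ^ n))"
    by (simp add: heat_def sum_distrib_right sum_divide_distrib mult.assoc)
  also have "\<dots> = exp (- t) * (\<Sum>y\<in>UNIV. Q x y * (\<Sum>n. (markov_op Q ^^ n) f y / fact n * t ^ n))"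
    by (subst suminf_sum, intro summable_mult heat_summable)
      (simp only: suminf_mult[OF heat_summable])
  also have "\<dots> = markov_op Q (heat Q t f) x"
    by (simp add: markov_op_def heat_def sum_distrib_left mult_ac)
  finally show ?thesis by (simp add: laplace_eq_markov_op)
qed

lemma heat_has_real_derivative:
  "((\<lambda>t. heat Q t f x) has_real_derivative laplace Q (heat Q t f) x) (at t within S)"
proof -
  have "((\<lambda>t. \<Sum>n. (markov_op Q ^^ n) f x / fact n * t ^ n) has_real_derivative
      (\<Sum>n. diffs (\<lambda>n. (markov_op Q ^^ n) f x / fact n) n * t ^ n)) (at t)"
    by (rule termdiffs_strong_converges_everywhere) (rule heat_summable)
  also have "diffs (\<lambda>n. (markov_op Q ^^ n) f x / fact n) = (\<lambda>n. (markov_op Q ^^ n) (markov_op Q f) x / fact n)"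
    by (simp add: diffs_def fun_eq_iff funpow_swap1 del: of_nat_Suc)
  finally have "((\<lambda>t. heat Q t f x) has_real_derivative heat Q t (markov_op Q f) x - heat Q t f x) (at t)"
    unfolding heat_def by (auto intro!: derivative_eq_intros)
  then show ?thesis
    by (auto simp: laplace_heat intro: has_field_derivative_at_within)
qed

lemma heat_pos:
  assumes "\<And>x. 0 < f x" "0 \<le> t"
  shows "0 < heat Q t f x"
proof -
  have "0 < (\<Sum>n. (markov_op Q ^^ n) f x / fact n * t ^ n)"
    using markov_op_funpow_nonneg[of f] assms less_imp_le[OF assms(1)]
    by (intro suminf_pos2[where i = 0] heat_summable) auto
  then show ?thesis by (simp add: heat_def)
qed

lemma heat_density:
  assumes "\<rho> \<in> densities \<pi>" "\<And>x. 0 < \<rho> x" "0 \<le> t"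
  shows "heat Q t \<rho> \<in> densities \<pi>"
proof -
  have "((\<lambda>t. \<Sum>x\<in>UNIV. \<pi> x * heat Q t \<rho> x) has_real_derivative
      (\<Sum>x\<in>UNIV. \<pi> x * laplace Q (heat Q t \<rho>) x)) (at t)" for t
    by (intro DERIV_sum DERIV_cmult heat_has_real_derivative)
  moreover have "(\<Sum>x\<in>UNIV. \<pi> x * laplace Q g x) = 0" for g
    using sum_laplace[of "\<lambda>_. 1" g] by (simp add: edge_sum_def mult.commute)
  ultimately have "(\<Sum>x\<in>UNIV. \<pi> x * heat Q t \<rho> x) = (\<Sum>x\<in>UNIV. \<pi> x * heat Q 0 \<rho> x)"
    by (intro DERIV_isconst_all) simp
  with assms heat_pos show ?thesis
    by (auto simp: densities_def less_imp_le)
qed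

lemma heat_gradient_estimate:
  assumes Ric: "entropic_Ric_ge Q \<pi> \<kappa>" and \<rho>: "\<rho> \<in> densities \<pi>" "\<And>x. 0 < \<rho> x" and "0 \<le> t"
  shows "action Q \<pi> \<rho> (heat Q t f) \<le> exp (- 2 * \<kappa> * t) * action Q \<pi> (heat Q t \<rho>) f"
proof -
  \<comment> \<open>Interpolation in the manner of Bakry and Emery: \<open>\<Phi> 0\<close> is the
    action of \<open>f\<close> at \<open>heat Q t \<rho>\<close>, and \<open>\<Phi> t\<close> is
    \<open>exp (2 * \<kappa> * t)\<close> times that of \<open>heat Q t f\<close> at
    \<open>\<rho>\<close>. The Hessian bound makes \<open>\<Phi>\<close> nonincreasing.\<close>
  define \<Phi> where "\<Phi> s = exp (2 * \<kappa> * s) * action Q \<pi> (heat Q (t - s) \<rho>) (heat Q s f)" for s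
  define \<Phi>' where "\<Phi>' s = exp (2 * \<kappa> * s) * (2 * (\<kappa> * action Q \<pi> (heat Q (t - s) \<rho>) (heat Q s f)
      - entropy_hessian Q \<pi> (heat Q (t - s) \<rho>) (heat Q s f)))" for s
  have deriv: "(\<Phi> has_real_derivative \<Phi>' s) (at s within {0..t})" if s: "s \<in> {0..t}" for s
  proof -
    have "((\<lambda>s. action Q \<pi> (heat Q (t - s) \<rho>) (heat Q s f)) has_real_derivative
        2 * (\<Sum>x\<in>UNIV. (laplace Q (heat Q s f) x * velocity Q (heat Q (t - s) \<rho>) (heat Q s f) x -
          (- laplace Q (heat Q (t - s) \<rho>) x) * force Q (heat Q (t - s) \<rho>) (heat Q s f) x) * \<pi> x)) (at s within {0..t})"
    proof (rule action_has_real_derivative)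
      fix x
      have "((\<lambda>s. heat Q (t - s) \<rho> x) has_real_derivative laplace Q (heat Q (t - s) \<rho>) x * (- 1)) (at s within {0..t})"
        by (rule DERIV_chain2[OF heat_has_real_derivative]) (auto intro!: derivative_eq_intros)
      then show "((\<lambda>s. heat Q (t - s) \<rho> x) has_real_derivative - laplace Q (heat Q (t - s) \<rho>) x) (at s within {0..t})"
        by simp
      show "((\<lambda>s. heat Q s f x) has_real_derivative laplace Q (heat Q s f) x) (at s within {0..t})"
        by (rule heat_has_real_derivative)
      show "0 < heat Q (t - s) \<rho> x" if "s \<in> {0..t}" for s x
        using that \<rho> by (intro heat_pos) auto
    qed (rule s)
    moreover have "((\<lambda>s. exp (2 * \<kappa> * s)) has_real_derivative 2 * \<kappa> * exp (2 * \<kappa> * s)) (at s within {0..t})"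
      by (auto intro!: derivative_eq_intros)
    ultimately show ?thesis
      unfolding \<Phi>_def[abs_def]
      by (intro DERIV_cong[OF DERIV_mult']) (auto simp: \<Phi>'_def entropy_hessian_def algebra_simps)
  qed
  have "\<Phi> t \<le> \<Phi> 0"
  proof (rule DERIV_nonpos_imp_decreasing_open[of 0 t \<Phi>])
    show "continuous_on {0..t} \<Phi>" using deriv by (rule DERIV_continuous_on)
    fix s assume s: "0 < s" "s < t"
    then have "at s within {0..t} = at s" by (intro at_within_interior) auto
    moreover have "\<kappa> * action Q \<pi> (heat Q (t - s) \<rho>) (heat Q s f) \<le> entropy_hessian Q \<pi> (heat Q (t - s) \<rho>) (heat Q s f)"
      using s \<rho> by (intro action_le_entropy_hessian[OF Ric] heat_density heat_pos) auto
    ultimately show "\<exists>y. DERIV \<Phi> s :> y \<and> y \<le> 0"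
      using deriv[of s] s by (intro exI[of _ "\<Phi>' s"]) (auto simp: \<Phi>'_def mult_le_0_iff)
  qed fact
  then show ?thesis
    by (simp add: \<Phi>_def exp_minus field_simps)
qed

text \<open>The logarithmic mean is at most the arithmetic mean; symmetrisation then reduces the
  bound to half the total mass of \<open>\<rho>\<close>.\<close>

lemma action_le_half:
  assumes "\<rho> \<in> densities \<pi>" "\<And>x. 0 < \<rho> x" and lip: "\<And>x y. 0 < Q x y \<Longrightarrow> \<bar>f y - f x\<bar> \<le> 1"
  shows "action Q \<pi> \<rho> f \<le> 1 / 2"
proof -
  have "action Q \<pi> \<rho> f \<le> edge_sum (\<lambda>x y. 1 / 2 * (\<rho> x + \<rho> y))"
    unfolding action_eq_edge_sum
  proof (rule edge_sum_mono)
    fix x y assume "0 < Q x y"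
    then have "(f y - f x)\<^sup>2 \<le> 1" using lip abs_square_le_1 by blast
    moreover have "rho_hat \<rho> x y \<le> 1 / 2 * (\<rho> x + \<rho> y)" "0 \<le> rho_hat \<rho> x y"
      using log_mean_le_arith[of "\<rho> x" "\<rho> y"] log_mean_pos[of "\<rho> x" "\<rho> y"] assms(2) by (auto simp: rho_hat_def)
    ultimately show "(f y - f x)\<^sup>2 * rho_hat \<rho> x y \<le> 1 / 2 * (\<rho> x + \<rho> y)"
      using mult_mono[of "(f y - f x)\<^sup>2" 1 "rho_hat \<rho> x y"] by fastforce
  qed
  also have "\<dots> = edge_sum (\<lambda>x y. \<rho> x)"
    unfolding edge_sum_cmult edge_sum_add using edge_sum_swap[of "\<lambda>x y. \<rho> x"] by simp
  also have "\<dots> = (\<Sum>x\<in>UNIV. \<rho> x * \<pi> x * (\<Sum>y\<in>UNIV. Q x y)) / 2"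
    by (simp add: edge_sum_def sum_distrib_left mult_ac)
  also have "\<dots> = 1 / 2"
    using assms(1) by (simp add: Q_sum densities_def mult.commute)
  finally show ?thesis .
qed

text \<open>Each edge from \<open>x\<close> to another vertex occurs in the action in both
  orientations, which cancels the factor one half; a loop contributes nothing because its gradient
  is zero.\<close>

lemma local_action_le_action:
  assumes "\<And>x. 0 \<le> \<rho> x"
  shows "(\<Sum>y\<in>UNIV. (g y - g x)\<^sup>2 * rho_hat \<rho> x y * Q x y) * \<pi> x \<le> action Q \<pi> \<rho> g"
proof -
  define H where "H a b = (if a = x then (g b - g a)\<^sup>2 * rho_hat \<rho> a b else 0)" for a b
  have "(\<Sum>y\<in>UNIV. (g y - g x)\<^sup>2 * rho_hat \<rho> x y * Q x y) * \<pi> x = 2 * edge_sum H"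
    unfolding edge_sum_def H_def
    by (subst sum.remove[of UNIV x]) (auto simp: sum_distrib_right)
  also have "\<dots> = edge_sum (\<lambda>a b. H a b + H b a)"
    using edge_sum_swap[of H] by (simp add: edge_sum_add)
  also have "\<dots> \<le> action Q \<pi> \<rho> g"
    unfolding action_eq_edge_sum
    by (rule edge_sum_mono)
      (auto simp: H_def rho_hat_def log_mean_commute power2_commute intro!: mult_nonneg_nonneg log_mean_nonneg assms)
  finally show ?thesis .
qed

text \<open>The variance of \<open>g y - g x\<close> under the transition probabilities from
  \<open>x\<close> is nonnegative.\<close>

lemma laplace_squared_le: "(laplace Q g x)\<^sup>2 \<le> (\<Sum>y\<in>UNIV. (g y - g x)\<^sup>2 * Q x y)"
proof -
  define L where "L = laplace Q g x"
  have "0 \<le> (\<Sum>y\<in>UNIV. (g y - g x - L)\<^sup>2 * Q x y)"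
    by (intro sum_nonneg mult_nonneg_nonneg Q_nonneg) auto
  also have "\<dots> = (\<Sum>y\<in>UNIV. (g y - g x)\<^sup>2 * Q x y - 2 * L * ((g y - g x) * Q x y) + L\<^sup>2 * Q x y)"
    by (intro sum.cong refl) (simp add: power2_eq_square algebra_simps)
  also have "\<dots> = (\<Sum>y\<in>UNIV. (g y - g x)\<^sup>2 * Q x y) - 2 * L * L + L\<^sup>2 * (\<Sum>y\<in>UNIV. Q x y)"
    unfolding sum.distrib sum_subtractf sum_distrib_left[symmetric] by (simp add: L_def laplace_def)
  finally show ?thesis
    by (simp add: Q_sum power2_eq_square flip: L_def)
qed

text \<open>Only the edges at \<open>x\<close> are kept in the action, with their weights bounded
  below by \<open>\<theta>\<close>; the choice of a good density remains open. Loops are exempt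
  since their gradient is zero.\<close>

lemma laplace_heat_bound:
  assumes Ric: "entropic_Ric_ge Q \<pi> \<kappa>" and \<rho>: "\<rho> \<in> densities \<pi>" "\<And>x. 0 < \<rho> x" and "0 \<le> t"
    and lip: "\<And>x y. 0 < Q x y \<Longrightarrow> \<bar>f y - f x\<bar> \<le> 1"
    and \<theta>: "\<And>y. 0 < Q x y \<Longrightarrow> y \<noteq> x \<Longrightarrow> \<theta> \<le> rho_hat \<rho> x y" "0 \<le> \<theta>"
  shows "(laplace Q (heat Q t f) x)\<^sup>2 * (\<theta> * \<pi> x) \<le> exp (- 2 * \<kappa> * t) / 2"
proof -
  define g where "g = heat Q t f"
  have "(laplace Q g x)\<^sup>2 * (\<theta> * \<pi> x) \<le> (\<Sum>y\<in>UNIV. (g y - g x)\<^sup>2 * Q x y) * (\<theta> * \<pi> x)"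
    using \<theta> \<pi>_pos[of x] by (intro mult_right_mono laplace_squared_le) auto
  also have "\<dots> = (\<Sum>y\<in>UNIV. (g y - g x)\<^sup>2 * \<theta> * Q x y) * \<pi> x"
    by (simp add: sum_distrib_left sum_distrib_right mult_ac)
  also have "\<dots> \<le> (\<Sum>y\<in>UNIV. (g y - g x)\<^sup>2 * rho_hat \<rho> x y * Q x y) * \<pi> x"
  proof (rule mult_right_mono[OF sum_mono])
    fix y
    show "(g y - g x)\<^sup>2 * \<theta> * Q x y \<le> (g y - g x)\<^sup>2 * rho_hat \<rho> x y * Q x y"
    proof (cases "Q x y = 0 \<or> y = x")
      case False
      with \<theta>(1)[of y] Q_nonneg[of x y] show ?thesis
        by (intro mult_left_mono mult_right_mono) auto
    qed auto
  qed (use \<pi>_pos[of x] in auto)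
  also have "\<dots> \<le> action Q \<pi> \<rho> g"
    using \<rho> by (intro local_action_le_action less_imp_le)
  also have "\<dots> \<le> exp (- 2 * \<kappa> * t) * action Q \<pi> (heat Q t \<rho>) f"
    unfolding g_def using Ric \<rho> \<open>0 \<le> t\<close> by (rule heat_gradient_estimate)
  also have "\<dots> \<le> exp (- 2 * \<kappa> * t) * (1 / 2)"
    using \<rho> \<open>0 \<le> t\<close> lip by (intro mult_left_mono action_le_half heat_density heat_pos) auto
  finally show ?thesis by (simp add: g_def)
qed

end

subsection \<open>The diameter bound\<close>

text \<open>The source of the constant in the theorem; its value 1 at \<open>D = 1\<close> comes
  from the diagonal value of the logarithmic mean.\<close>

lemma log_mean_one_inverse:
  assumes "1 \<le> D"
  shows "log_mean 1 (1 / D) = 1 / (if D = 1 then 1 else D * ln D / (D - 1))"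
proof (cases "D = 1")
  case False
  with assms have "log_mean 1 (1 / D) = (1 - 1 / D) / ln D"
    by (auto simp: log_mean_def ln_div)
  also have "\<dots> = (D - 1) / (D * ln D)"
    using assms by (simp add: field_simps)
  finally show ?thesis using False by simp
qed (simp add: log_mean_def)

text \<open>Some vertex has positive mass, and detailed balance propagates positivity along
  edges.\<close>

lemma irreducible_reversible_stationary_pos:
  assumes markov: "markov_kernel Q" and irr: "irreducible_kernel Q"
    and stat: "stationary Q \<pi>" and rev: "reversible_kernel Q \<pi>"
  shows "0 < \<pi> x"
proof -
  have "\<exists>x0. \<pi> x0 \<noteq> 0"
  proof (rule ccontr)
    assume "\<nexists>x0. \<pi> x0 \<noteq> 0"
    then have "(\<Sum>x\<in>UNIV. \<pi> x) = 0" by simp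
    with stat show False by (simp add: stationary_def)
  qed
  then obtain x0 where x0: "0 < \<pi> x0"
    using stat by (auto simp: stationary_def less_le)
  have "(adjacent Q)\<^sup>*\<^sup>* x0 x"
    using irr by (simp add: irreducible_kernel_def)
  then show ?thesis
  proof (induction rule: rtranclp_induct)
    case (step y z)
    then have "0 < Q y z * \<pi> y" by (simp add: adjacent_def)
    also have "\<dots> = Q z y * \<pi> z" using rev by (simp add: reversible_kernel_def)
    finally have "\<pi> z \<noteq> 0" by auto
    with stat show ?case by (auto simp: stationary_def less_le)
  qed (rule x0)
qed

lemma graph_dist_step:
  assumes irr: "irreducible_kernel Q" and adj: "adjacent Q a b"
  shows "graph_dist Q x b \<le> Suc (graph_dist Q x a)"
proof -
  have "\<exists>n. (adjacent Q ^^ n) x a"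
    using irr by (auto simp: irreducible_kernel_def intro: rtranclp_imp_relpowp)
  then have "(adjacent Q ^^ graph_dist Q x a) x a"
    unfolding graph_dist_def by (rule LeastI_ex)
  then have "(adjacent Q ^^ Suc (graph_dist Q x a)) x b"
    using adj by (rule relpowp_Suc_I)
  then show ?thesis
    unfolding graph_dist_def by (rule Least_le)
qed

lemma graph_dist_self: "graph_dist Q x x = 0"
  unfolding graph_dist_def by (rule Least_eq_0) simp

section \<open>Long-time behaviour and the pointwise Laplacian bound\<close>

context reversible_chain
begin

text \<open>The gradient estimate at the constant density 1 makes the difference across each edge
  decay exponentially; the differences are added along a path. This replaces an explicit limit of
  the semigroup.\<close>

lemma heat_diff_tendsto_0:
  assumes Ric: "entropic_Ric_ge Q \<pi> \<kappa>" and "0 < \<kappa>"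
    and lip: "\<And>x y. 0 < Q x y \<Longrightarrow> \<bar>f y - f x\<bar> \<le> 1"
    and path: "(adjacent Q)\<^sup>*\<^sup>* x y"
  shows "((\<lambda>t. heat Q t f y - heat Q t f x) \<longlongrightarrow> 0) at_top"
  using path
proof (induction rule: rtranclp_induct)
  case (step y z)
  define c where "c = 1 / (2 * Q y z * \<pi> y)"
  have Q_pos: "0 < Q y z" using step by (simp add: adjacent_def)
  have one: "(\<lambda>_. 1) \<in> densities \<pi>" by (simp add: densities_def \<pi>_sum)
  have "(heat Q t f z - heat Q t f y)\<^sup>2 \<le> c * exp (- 2 * \<kappa> * t)" if "0 \<le> t" for t
  proof -
    define g where "g = heat Q t f"
    have "(g z - g y)\<^sup>2 * Q y z * \<pi> y \<le> (\<Sum>w\<in>UNIV. (g w - g y)\<^sup>2 * rho_hat (\<lambda>_. 1) y w * Q y w) * \<pi> y"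
      using member_le_sum[of z UNIV "\<lambda>w. (g w - g y)\<^sup>2 * Q y w"] Q_nonneg \<pi>_pos[of y]
      by (intro mult_right_mono) (auto simp: rho_hat_def log_mean_def)
    also have "\<dots> \<le> action Q \<pi> (\<lambda>_. 1) g" by (rule local_action_le_action) simp
    also have "\<dots> \<le> exp (- 2 * \<kappa> * t) * action Q \<pi> (heat Q t (\<lambda>_. 1)) f"
      unfolding g_def using Ric one that by (intro heat_gradient_estimate) auto
    also have "\<dots> \<le> exp (- 2 * \<kappa> * t) * (1 / 2)"
      using one that lip by (intro mult_left_mono action_le_half heat_density heat_pos) auto
    finally show ?thesis
      using Q_pos \<pi>_pos[of y] by (simp add: c_def g_def field_simps)
  qed
  then have bound: "eventually (\<lambda>t. norm ((heat Q t f z - heat Q t f y)\<^sup>2) \<le> c * exp (- 2 * \<kappa> * t)) at_top"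
    by (intro eventually_mono[OF eventually_ge_at_top[of 0]]) simp
  have "((\<lambda>t. c * exp (- 2 * \<kappa> * t)) \<longlongrightarrow> c * 0) at_top"
  proof (intro tendsto_mult tendsto_const filterlim_compose[OF exp_at_bot])
    have "filterlim (\<lambda>t. (2 * \<kappa>) * t) at_top at_top"
      using \<open>0 < \<kappa>\<close> by (intro filterlim_tendsto_pos_mult_at_top[OF tendsto_const] filterlim_ident) auto
    then show "filterlim (\<lambda>t. - 2 * \<kappa> * t) at_bot at_top"
      by (simp add: filterlim_uminus_at_bot)
  qed
  then have "((\<lambda>t. (heat Q t f z - heat Q t f y)\<^sup>2) \<longlongrightarrow> 0) at_top"
    by (intro Lim_null_comparison[OF bound]) simp
  from tendsto_real_sqrt[OF this] have "((\<lambda>t. heat Q t f z - heat Q t f y) \<longlongrightarrow> 0) at_top"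
    by (simp add: tendsto_rabs_zero_iff)
  from tendsto_add[OF step.IH this] show ?case by simp
qed simp

text \<open>The derivative bound is integrated without integrals: adding
  \<open>C / \<kappa> * exp (- \<kappa> * t)\<close> to the heat flow gives a nonincreasing
  function, and subtracting it a nondecreasing one.\<close>

lemma heat_displacement:
  assumes "0 < \<kappa>" and bound: "\<And>t. 0 \<le> t \<Longrightarrow> \<bar>laplace Q (heat Q t f) x\<bar> \<le> C * exp (- \<kappa> * t)"
    and "0 \<le> t"
  shows "\<bar>heat Q t f x - f x\<bar> \<le> C / \<kappa>"
proof -
  have heat_deriv: "((\<lambda>t. heat Q t f x) has_real_derivative laplace Q (heat Q t f) x) (at t)" for t
    by (rule heat_has_real_derivative)
  have exp_deriv: "((\<lambda>t. C / \<kappa> * exp (- \<kappa> * t)) has_real_derivative - (C * exp (- \<kappa> * t))) (at t)" for t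
    using \<open>0 < \<kappa>\<close> by (auto intro!: derivative_eq_intros)
  have "heat Q t f x + C / \<kappa> * exp (- \<kappa> * t) \<le> heat Q 0 f x + C / \<kappa> * exp (- \<kappa> * 0)"
  proof (rule DERIV_nonpos_imp_nonincreasing[OF \<open>0 \<le> t\<close>])
    fix s :: real assume "0 \<le> s"
    show "\<exists>y. DERIV (\<lambda>t. heat Q t f x + C / \<kappa> * exp (- \<kappa> * t)) s :> y \<and> y \<le> 0"
    proof (intro exI conjI)
      show "DERIV (\<lambda>t. heat Q t f x + C / \<kappa> * exp (- \<kappa> * t)) s :> laplace Q (heat Q s f) x + - (C * exp (- \<kappa> * s))"
        by (rule DERIV_add[OF heat_deriv exp_deriv])
      show "laplace Q (heat Q s f) x + - (C * exp (- \<kappa> * s)) \<le> 0"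
        using bound[OF \<open>0 \<le> s\<close>] by auto
    qed
  qed
  moreover have "heat Q 0 f x - C / \<kappa> * exp (- \<kappa> * 0) \<le> heat Q t f x - C / \<kappa> * exp (- \<kappa> * t)"
  proof (rule DERIV_nonneg_imp_nondecreasing[OF \<open>0 \<le> t\<close>])
    fix s :: real assume "0 \<le> s"
    show "\<exists>y. DERIV (\<lambda>t. heat Q t f x - C / \<kappa> * exp (- \<kappa> * t)) s :> y \<and> 0 \<le> y"
    proof (intro exI conjI)
      show "DERIV (\<lambda>t. heat Q t f x - C / \<kappa> * exp (- \<kappa> * t)) s :> laplace Q (heat Q s f) x - - (C * exp (- \<kappa> * s))"
        by (rule DERIV_diff[OF heat_deriv exp_deriv])
      show "0 \<le> laplace Q (heat Q s f) x - - (C * exp (- \<kappa> * s))"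
        using bound[OF \<open>0 \<le> s\<close>] by auto
    qed
  qed
  moreover have "0 \<le> C / \<kappa> * exp (- \<kappa> * t)"
  proof -
    have "0 \<le> C" using bound[of 0] by auto
    with \<open>0 < \<kappa>\<close> show ?thesis by simp
  qed
  ultimately show ?thesis
    by (simp add: abs_le_iff)
qed

text \<open>The test density is proportional to 1 at \<open>x\<close>, to \<open>1 / D\<close> on its neighbours and to
  \<open>\<epsilon>\<close> elsewhere; \<open>\<epsilon> > 0\<close> is needed because the gradient estimate is only available for
  strictly positive densities.\<close>

lemma laplace_heat_bound_srw:
  assumes Ric: "entropic_Ric_ge Q \<pi> \<kappa>" and "0 \<le> t"
    and lip: "\<And>x y. 0 < Q x y \<Longrightarrow> \<bar>f y - f x\<bar> \<le> 1"
    and D: "1 \<le> D" "\<And>x y. 0 < Q x y \<Longrightarrow> 1 \<le> D * Q x y"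
  shows "(laplace Q (heat Q t f) x)\<^sup>2 \<le> (if D = 1 then 1 else D * ln D / (D - 1)) * exp (- 2 * \<kappa> * t)"
    (is "?X \<le> ?c * ?E")
proof (rule field_le_epsilon)
  fix e :: real assume "0 < e"
  have c: "0 < ?c"
    using D(1) by auto
  \<comment> \<open>Chosen so that the error in the final estimate is exactly
    \<open>e\<close>.\<close>
  define \<epsilon> where "\<epsilon> = e * 2 * \<pi> x / (?c * ?E)"
  have "0 < \<epsilon>" using \<open>0 < e\<close> c \<pi>_pos[of x] by (simp add: \<epsilon>_def)
  define r where "r y = (if y = x then 1 else if 0 < Q x y then 1 / D else \<epsilon>)" for y
  have r_pos: "0 < r y" for y using D(1) \<open>0 < \<epsilon>\<close> by (simp add: r_def)
  define M where "M = (\<Sum>y\<in>UNIV. \<pi> y * r y)"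
  have "0 < M" unfolding M_def using r_pos \<pi>_pos by (intro sum_pos) auto
  \<comment> \<open>The vertex \<open>x\<close> contributes \<open>\<pi> x\<close>, and by detailed
    balance its neighbours together contribute at most \<open>\<pi> x\<close> again. The resulting
    factor 2 cancels the one half in \<open>laplace_heat_bound\<close>.\<close>
  have "M \<le> (\<Sum>y\<in>UNIV. (if y = x then \<pi> x else 0) + \<pi> x * Q x y + \<epsilon> * \<pi> y)"
    unfolding M_def
  proof (rule sum_mono)
    fix y
    have nonneg: "0 \<le> \<pi> x * Q x y" "0 \<le> \<epsilon> * \<pi> y"
      using \<pi>_pos[of x] \<pi>_pos[of y] Q_nonneg \<open>0 < \<epsilon>\<close> by auto
    have "\<pi> y / D \<le> \<pi> x * Q x y" if "0 < Q x y"
    proof -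
      have eq: "\<pi> x * Q x y = \<pi> y * Q y x" using reversible[of x y] by (simp add: mult.commute)
      moreover have "0 < \<pi> x * Q x y" using that \<pi>_pos by simp
      ultimately have "0 < Q y x" using \<pi>_pos[of y] by (simp add: zero_less_mult_iff)
      from D(2)[OF this] have "\<pi> y * 1 \<le> \<pi> y * (D * Q y x)"
        using \<pi>_pos[of y] by (intro mult_left_mono) auto
      then show ?thesis using D(1) by (simp add: eq divide_le_eq mult_ac)
    qed
    with nonneg show "\<pi> y * r y \<le> (if y = x then \<pi> x else 0) + \<pi> x * Q x y + \<epsilon> * \<pi> y"
      by (auto simp: r_def)
  qed
  also have "\<dots> = 2 * \<pi> x + \<epsilon>"
    by (simp add: sum.distrib Q_sum \<pi>_sum flip: sum_distrib_left)
  finally have M_le: "M \<le> 2 * \<pi> x + \<epsilon>" .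
  define \<rho> where "\<rho> y = r y / M" for y
  have \<rho>_pos: "0 < \<rho> y" for y using r_pos \<open>0 < M\<close> by (simp add: \<rho>_def)
  have "(\<Sum>y\<in>UNIV. \<pi> y * \<rho> y) = M / M"
    unfolding \<rho>_def times_divide_eq_right sum_divide_distrib[symmetric] by (simp add: M_def)
  with \<open>0 < M\<close> \<rho>_pos have dens: "\<rho> \<in> densities \<pi>"
    by (auto simp: densities_def less_imp_le)
  have hat: "1 / (M * ?c) \<le> rho_hat \<rho> x y" if "0 < Q x y" "y \<noteq> x" for y
  proof -
    have "rho_hat \<rho> x y = log_mean (1 / M * 1) (1 / M * (1 / D))"
      using that by (simp add: rho_hat_def \<rho>_def r_def mult.commute)
    also have "\<dots> = 1 / M * log_mean 1 (1 / D)"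
      using \<open>0 < M\<close> D(1) by (intro log_mean_cmult) auto
    finally show ?thesis
      using log_mean_one_inverse[OF D(1)] by simp
  qed
  have "?X * (1 / (M * ?c) * \<pi> x) \<le> ?E / 2"
    using c \<open>0 < M\<close>
    by (intro laplace_heat_bound[OF Ric dens \<rho>_pos \<open>0 \<le> t\<close> lip hat]) (auto simp del: if_split)
  then have "?X \<le> ?c * ?E * M / (2 * \<pi> x)"
    using c \<open>0 < M\<close> \<pi>_pos[of x] by (simp add: field_simps del: if_split)
  also have "\<dots> \<le> ?c * ?E * (2 * \<pi> x + \<epsilon>) / (2 * \<pi> x)"
    using M_le c \<pi>_pos[of x] by (intro divide_right_mono mult_left_mono) auto
  also have "\<dots> = ?c * ?E + e"
    using c \<pi>_pos[of x] unfolding \<epsilon>_def by (simp add: field_simps del: if_split)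
  finally show "?X \<le> ?c * ?E + e" .
qed

end

theorem theorem1p3:
  fixes Q :: "'a::finite \<Rightarrow> 'a \<Rightarrow> real" and \<pi> :: "'a \<Rightarrow> real" and \<kappa> :: real and D :: nat
  assumes "markov_kernel Q"
    and "irreducible_kernel Q"
    and "stationary Q \<pi>"
    and "reversible_kernel Q \<pi>"
    and "simple_random_walk Q"
    and "D = max_degree Q"
    and "\<kappa> > 0"
    and "entropic_Ric_ge Q \<pi> \<kappa>"
  shows "real (graph_diam Q) \<le>
    2 / \<kappa> * sqrt (if D = 1 then 1 else real D * ln (real D) / (real D - 1))"
proof -
  interpret reversible_chain Q \<pi>
    using assms(1,3,4) irreducible_reversible_stationary_pos[OF assms(1-4)]
    by unfold_locales (auto simp: markov_kernel_def stationary_def reversible_kernel_def)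
  have deg: "1 \<le> vdegree Q x \<and> vdegree Q x \<le> D \<and> Q x y = 1 / real (vdegree Q x)" if "0 < Q x y" for x y
  proof -
    have y: "y \<in> neighbours Q x" using that by (simp add: neighbours_def adjacent_def)
    then have "0 < vdegree Q x" unfolding vdegree_def by (auto simp: card_gt_0_iff)
    moreover have "vdegree Q x \<le> D" unfolding assms(6) max_degree_def by (intro Max_ge) auto
    ultimately show ?thesis using assms(5) y by (simp add: simple_random_walk_def)
  qed
  have "\<exists>y. 0 < Q x y" for x
  proof (rule ccontr)
    assume "\<nexists>y. 0 < Q x y"
    then have "Q x y = 0" for y using Q_nonneg[of x y] by (metis less_le)
    with Q_sum[of x] show False by simp
  qed
  with deg have D1: "1 \<le> D" by (meson order_trans)
  have DQ: "1 \<le> real D * Q x y" if "0 < Q x y" for x y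
    using deg[OF that] by simp
  define c where "c = (if D = 1 then 1 else real D * ln (real D) / (real D - 1))"
  have c_eq: "c = (if real D = 1 then 1 else real D * ln (real D) / (real D - 1))"
    by (simp add: c_def)
  obtain x0 y0 where diam: "graph_diam Q = graph_dist Q x0 y0"
  proof -
    have "graph_diam Q \<in> range (\<lambda>(x, y). graph_dist Q x y)"
      unfolding graph_diam_def by (intro Max_in) auto
    then show ?thesis using that by auto
  qed
  define f where "f x = real (graph_dist Q x0 x)" for x
  have lip: "\<bar>f y - f x\<bar> \<le> 1" if "0 < Q x y" for x y
  proof -
    have "0 < Q x y * \<pi> x" using that \<pi>_pos by simp
    then have "0 < Q y x"
      unfolding reversible[of x y] using \<pi>_pos[of y] by (simp add: zero_less_mult_iff)
    with that graph_dist_step[OF assms(2), of x y x0] graph_dist_step[OF assms(2), of y x x0]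
    show ?thesis by (auto simp: adjacent_def f_def)
  qed
  have bound: "\<bar>laplace Q (heat Q t f) x\<bar> \<le> sqrt c * exp (- \<kappa> * t)" if "0 \<le> t" for t x
  proof -
    have "(laplace Q (heat Q t f) x)\<^sup>2 \<le> c * exp (- 2 * \<kappa> * t)"
      unfolding c_eq using assms(8) that lip D1 DQ by (intro laplace_heat_bound_srw) auto
    then have "\<bar>laplace Q (heat Q t f) x\<bar> \<le> sqrt (c * exp (- 2 * \<kappa> * t))"
      by (metis real_sqrt_abs real_sqrt_le_iff)
    also have "exp (- 2 * \<kappa> * t) = (exp (- \<kappa> * t))\<^sup>2"
      by (simp add: power2_eq_square flip: exp_add)
    finally show ?thesis by (simp add: real_sqrt_mult)
  qed
  \<comment> \<open>At each endpoint the heat flow moves \<open>f\<close> by at most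
    \<open>sqrt c / \<kappa>\<close>, while the difference of the evolved values tends to 0.\<close>
  have "f y0 - f x0 - 2 * (sqrt c / \<kappa>) \<le> 0"
  proof (rule tendsto_lowerbound)
    show "((\<lambda>t. heat Q t f y0 - heat Q t f x0) \<longlongrightarrow> 0) at_top"
      using assms(2) heat_diff_tendsto_0[OF assms(8,7) lip] by (simp add: irreducible_kernel_def)
    show "eventually (\<lambda>t. f y0 - f x0 - 2 * (sqrt c / \<kappa>) \<le> heat Q t f y0 - heat Q t f x0) at_top"
      using eventually_ge_at_top[of 0]
    proof eventually_elim
      case (elim t)
      have "\<bar>heat Q t f x - f x\<bar> \<le> sqrt c / \<kappa>" for x
        using assms(7) bound elim by (rule heat_displacement)
      from this[of x0] this[of y0] show ?case by (simp add: abs_le_iff)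
    qed
  qed simp
  then show ?thesis
    by (simp add: diam f_def graph_dist_self c_def)
qed

end
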